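(* For every grapheur $\mathsf M\in\mathcal M$ and every $\epsilon>0$, letting $k=\lceil(174/\epsilon)^2\rceil$, there exist $N\le 2k$ and a graph $G\in\Delta^{N\times N}$ all of whose entries are integer multiples of $1/k$ (i.e., a graph on $k$ edges, counted with multiplicity and normalized) such that $W_\square(\mathsf M,\mathsf M_G)\le\epsilon$.
   Context: A grapheur is a random probability measure on $[0,1]^2$ of the form $\sum_{i,j}E_{i,j}\delta_{(T_i,T_j)}+\sum_i[\sigma_i(\delta_{T_i}\otimes\lambda)+\varsigma_i(\lambda\otimes\delta_{T_i})]+\theta\lambda^2+\vartheta\lambda_D$ ($T_i$ iid uniform on $[0,1]$; $\lambda,\lambda^2$ Lebesgue; $\lambda_D$ uniform probability on the diagonal; deterministic nonnegative coefficients summing to $1$); $\mathcal M$ is the set of grapheurs. $\Delta^{N\times N}$: nonnegative $N\times N$ matrices with entries summing to $1$. For $G\in\Delta^{N\times N}$, $\mathsf M_G=\sum_{i,j}G_{i,j}\delta_{(T_i,T_j)}$ with $T_i$ iid uniform. $W_\square(\mathsf M_1,\mathsf M_2)=\inf\sup_{S,T\subseteq[0,1]\text{ intervals}}\mathbb E|\mathsf M_1'(S\times T)-\mathsf M_2'(S\times T)|$, the infimum over couplings $(\mathsf M_1',\mathsf M_2')$ of $\mathsf M_1,\mathsf M_2$. *)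

theory Defs
  imports "HOL-Probability.Probability"
begin

text \<open>Coefficients of a grapheur: E i j, sigma i, varsigma i, theta, vartheta
  (indices over nat; finitely many nonzero coefficients is a special case).\<close>
definition is_grapheur ::
  "(nat \<Rightarrow> nat \<Rightarrow> real) \<Rightarrow> (nat \<Rightarrow> real) \<Rightarrow> (nat \<Rightarrow> real) \<Rightarrow> real \<Rightarrow> real \<Rightarrow> bool" where
  "is_grapheur E \<sigma> vs \<theta> vt \<longleftrightarrow>
     (\<forall>i j. E i j \<ge> 0) \<and> (\<forall>i. \<sigma> i \<ge> 0) \<and> (\<forall>i. vs i \<ge> 0) \<and> \<theta> \<ge> 0 \<and> vt \<ge> 0 \<and>
     (\<Sum>i. \<Sum>j. ennreal (E i j)) + (\<Sum>i. ennreal (\<sigma> i)) + (\<Sum>i. ennreal (vs i))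
       + ennreal \<theta> + ennreal vt = 1"

text \<open>The (deterministic) measure on the plane obtained for a realisation t of the
  points T_i:  sum E_ij delta_(t_i,t_j) + sum sigma_i (delta_(t_i) x lambda)
  + sum varsigma_i (lambda x delta_(t_i)) + theta lambda^2 + vartheta lambda_D,
  where lambda is Lebesgue measure on [0,1] and lambda_D the uniform probability
  on the diagonal of the unit square.\<close>
definition grapheur_measure ::
  "(nat \<Rightarrow> nat \<Rightarrow> real) \<Rightarrow> (nat \<Rightarrow> real) \<Rightarrow> (nat \<Rightarrow> real) \<Rightarrow> real \<Rightarrow> real \<Rightarrow>
   (nat \<Rightarrow> real) \<Rightarrow> (real \<times> real) measure" where
  "grapheur_measure E \<sigma> vs \<theta> vt t = measure_of UNIV (sets (borel :: (real \<times> real) measure))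
     (\<lambda>A. (\<Sum>i. \<Sum>j. ennreal (E i j) * indicator A (t i, t j))
        + (\<Sum>i. ennreal (\<sigma> i) * emeasure lborel {y \<in> {0..1}. (t i, y) \<in> A})
        + (\<Sum>i. ennreal (vs i) * emeasure lborel {x \<in> {0..1}. (x, t i) \<in> A})
        + ennreal \<theta> * emeasure (lborel :: (real \<times> real) measure) (A \<inter> ({0..1} \<times> {0..1}))
        + ennreal vt * emeasure lborel {x \<in> {0..1}. (x, x) \<in> A})"

definition iid_uniform :: "(nat \<Rightarrow> real) measure" where
  "iid_uniform = PiM UNIV (\<lambda>_. uniform_measure lborel {0..1::real})"

abbreviation RPM :: "(real \<times> real) measure measure" where
  "RPM \<equiv> prob_algebra (borel :: (real \<times> real) measure)"

definition grapheur_law ::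
  "(nat \<Rightarrow> nat \<Rightarrow> real) \<Rightarrow> (nat \<Rightarrow> real) \<Rightarrow> (nat \<Rightarrow> real) \<Rightarrow> real \<Rightarrow> real \<Rightarrow>
   (real \<times> real) measure measure" where
  "grapheur_law E \<sigma> vs \<theta> vt = distr iid_uniform RPM (grapheur_measure E \<sigma> vs \<theta> vt)"

definition in_Delta :: "nat \<Rightarrow> (nat \<Rightarrow> nat \<Rightarrow> real) \<Rightarrow> bool" where
  "in_Delta N G \<longleftrightarrow> (\<forall>i<N. \<forall>j<N. G i j \<ge> 0) \<and> (\<Sum>i<N. \<Sum>j<N. G i j) = 1"

definition graph_law :: "nat \<Rightarrow> (nat \<Rightarrow> nat \<Rightarrow> real) \<Rightarrow> (real \<times> real) measure measure" where
  "graph_law N G = grapheur_law (\<lambda>i j. if i < N \<and> j < N then G i j else 0) (\<lambda>_. 0) (\<lambda>_. 0) 0 0"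

definition couplings ::
  "(real \<times> real) measure measure \<Rightarrow> (real \<times> real) measure measure \<Rightarrow>
   ((real \<times> real) measure \<times> (real \<times> real) measure) measure set" where
  "couplings L1 L2 = {\<pi>. sets \<pi> = sets (RPM \<Otimes>\<^sub>M RPM) \<and> prob_space \<pi> \<and>
      distr \<pi> RPM fst = L1 \<and> distr \<pi> RPM snd = L2}"

definition W_box ::
  "(real \<times> real) measure measure \<Rightarrow> (real \<times> real) measure measure \<Rightarrow> ennreal" where
  "W_box L1 L2 = (INF \<pi>\<in>couplings L1 L2.
      SUP (S, T)\<in>{(S, T). is_interval S \<and> S \<subseteq> {0..1} \<and> is_interval T \<and> T \<subseteq> {0..1::real}}.
        \<integral>\<^sup>+ p. ennreal \<bar>measure (fst p) (S \<times> T) - measure (snd p) (S \<times> T)\<bar> \<partial>\<pi>)"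

end

theory Submission
  imports Defs
begin

text \<open>
  In \<^const>\<open>W_box\<close> the supremum over rectangles stands outside the expectation, so second moments
  suffice. First truncate the coefficients of the grapheur and replace \<open>\<lambda>\<close> by the empirical measure
  of many further vertices; up to an arbitrarily small error this leaves a finite weighted graph
  \<open>H\<close> of total weight 1. Then choose \<open>k\<close> edges from \<open>H\<close>: with \<open>D\<close> the normalized edge count minus
  \<open>H\<close>, Maurey's sampling argument makes the sum of the squares of the total off-diagonal and diagonal
  weights, the off-diagonal row and column sums, and the entries of \<open>D\<close> at most \<open>4 / k\<close>. Expanding
  the indicators \<open>1_S (T_i)\<close> and \<open>1_T (T_j)\<close> around their means splits \<open>\<Sum> D_ij 1_S (T_i) 1_T (T_j)\<close>
  into sums of orthogonal terms with exactly these coefficients, so its second moment is \<open>O(1 / k)\<close>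
  uniformly in \<open>S\<close> and \<open>T\<close>. The coupling uses the same \<open>T_i\<close> on both sides, after renaming the
  at most \<open>2 k\<close> endpoints of the chosen edges.
\<close>

section \<open>The random measure of a grapheur\<close>

lemma countably_additive_add:
  fixes f g :: "'a set \<Rightarrow> ennreal"
  assumes "countably_additive M f" "countably_additive M g"
  shows "countably_additive M (\<lambda>A. f A + g A)"
  using assms by (auto simp: countably_additive_def suminf_add[symmetric])

lemma countably_additive_cmult:
  fixes f :: "'a set \<Rightarrow> ennreal"
  assumes "countably_additive M f"
  shows "countably_additive M (\<lambda>A. c * f A)"
  using assms by (auto simp: countably_additive_def)

text \<open>Two infinite series in \<open>ennreal\<close> have to be interchanged. Reading one of
  them as an integral over the counting measure makes this an instance of
  \<open>nn_integral_suminf\<close>.\<close>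

lemma countably_additive_suminf:
  fixes f :: "nat \<Rightarrow> 'a set \<Rightarrow> ennreal"
  assumes "\<And>n. countably_additive M (f n)"
  shows "countably_additive M (\<lambda>A. \<Sum>n. f n A)"
proof (rule countably_additiveI)
  fix A :: "nat \<Rightarrow> 'a set"
  assume A: "range A \<subseteq> M" "disjoint_family A" "\<Union> (range A) \<in> M"
  have "(\<Sum>i. \<Sum>n. f n (A i)) = (\<Sum>n. \<Sum>i. f n (A i))"
    using nn_integral_suminf[of "\<lambda>n i. f n (A i)" "count_space (UNIV :: nat set)"]
    by (simp add: nn_integral_count_space_nat)
  also have "\<dots> = (\<Sum>n. f n (\<Union> (range A)))"
    using assms A by (auto simp: countably_additive_def)
  finally show "(\<Sum>i. \<Sum>n. f n (A i)) = (\<Sum>n. f n (\<Union> (range A)))" .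
qed

text \<open>Each kind of summand of a grapheur agrees on Borel sets with a genuine measure and
  inherits countable additivity from it.\<close>

lemma countably_additive_emeasureI:
  assumes "\<And>A. A \<in> M \<Longrightarrow> f A = emeasure N A" "sets N = M"
  shows "countably_additive M f"
proof (rule countably_additiveI)
  fix A :: "nat \<Rightarrow> 'a set"
  assume A: "range A \<subseteq> M" "disjoint_family A" "\<Union> (range A) \<in> M"
  then show "(\<Sum>i. f (A i)) = f (\<Union> (range A))"
    using assms suminf_emeasure[of A N] by (auto simp: range_subsetD)
qed

section \<open>The uniform law on the unit interval and its images\<close>

abbreviation unif :: "real measure" where
  "unif \<equiv> uniform_measure lborel {0..1}"

lemma prob_space_unif: "prob_space unif"
  by (rule prob_space_uniform_measure) auto

lemma emeasure_unif: "A \<in> sets borel \<Longrightarrow> emeasure unif A = emeasure lborel ({0..1} \<inter> A)"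
  by (simp add: emeasure_uniform_measure divide_ennreal_def)

lemma emeasure_distr_unif:
  assumes [measurable]: "A \<in> sets borel" "f \<in> borel_measurable borel"
  shows "emeasure (distr unif borel f) A = emeasure lborel {x \<in> {0..1}. f x \<in> A}"
proof -
  have "f -` A \<in> sets borel"
    using measurable_sets[OF assms(2,1)] by simp
  moreover have "{0..1} \<inter> f -` A = {x \<in> {0..1}. f x \<in> A}" by auto
  ultimately show ?thesis
    by (simp add: emeasure_distr emeasure_unif divide_ennreal_def)
qed

lemma emeasure_unit_square: "emeasure lborel ({0..1::real} \<times> {0..1::real}) = 1"
  by (simp add: lborel_prod[symmetric] lborel.emeasure_pair_measure_Times)

section \<open>Evaluation and measurability of the random measure\<close>

lemma sets_grapheur_measure [simp, measurable_cong]: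
  "sets (grapheur_measure E \<sigma> vs \<theta> vt t) = sets borel"
  unfolding grapheur_measure_def using sets.sigma_sets_eq[of borel] by simp

lemma space_grapheur_measure [simp]: "space (grapheur_measure E \<sigma> vs \<theta> vt t) = UNIV"
  using sets_eq_imp_space_eq[OF sets_grapheur_measure] by simp

text \<open>\<open>measure_of\<close> returns its set function only once that is known to be
  countably additive. The five kinds of summand come from point masses, from the images of the
  uniform law on a vertical segment, a horizontal segment and the diagonal, and from the uniform law
  on the square.\<close>

lemma emeasure_grapheur_measure:
  assumes A: "A \<in> sets borel"
  shows "emeasure (grapheur_measure E \<sigma> vs \<theta> vt t) A =
      (\<Sum>i. \<Sum>j. ennreal (E i j) * indicator A (t i, t j))
        + (\<Sum>i. ennreal (\<sigma> i) * emeasure lborel {y \<in> {0..1}. (t i, y) \<in> A})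
        + (\<Sum>i. ennreal (vs i) * emeasure lborel {x \<in> {0..1}. (x, t i) \<in> A})
        + ennreal \<theta> * emeasure (lborel :: (real \<times> real) measure) (A \<inter> ({0..1} \<times> {0..1}))
        + ennreal vt * emeasure lborel {x \<in> {0..1}. (x, x) \<in> A}" (is "_ = ?f A")
proof (rule emeasure_measure_of[OF grapheur_measure_def])
  show "positive (sets (grapheur_measure E \<sigma> vs \<theta> vt t)) ?f"
    by (simp add: positive_def)
  have ca1: "countably_additive (sets borel) (\<lambda>A. indicator A (t i, t j) :: ennreal)" for i j
    by (rule countably_additive_emeasureI[where N="return borel (t i, t j)"]) auto
  have ca2: "countably_additive (sets borel) (\<lambda>A. emeasure lborel {y \<in> {0..1::real}. (t i, y) \<in> A})" for i
    by (rule countably_additive_emeasureI[where N="distr unif borel (\<lambda>y. (t i, y))"])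
       (auto simp: emeasure_distr_unif)
  have ca3: "countably_additive (sets borel) (\<lambda>A. emeasure lborel {x \<in> {0..1::real}. (x, t i) \<in> A})" for i
    by (rule countably_additive_emeasureI[where N="distr unif borel (\<lambda>x. (x, t i))"])
       (auto simp: emeasure_distr_unif)
  have ca4: "countably_additive (sets borel)
      (\<lambda>A. emeasure (lborel :: (real \<times> real) measure) (A \<inter> ({0..1} \<times> {0..1})))"
    by (rule countably_additive_emeasureI[where N="uniform_measure lborel ({0..1} \<times> {0..1})"])
       (auto simp: emeasure_uniform_measure emeasure_unit_square Int_commute borel_Times divide_ennreal_def)
  have ca5: "countably_additive (sets borel) (\<lambda>A. emeasure lborel {x \<in> {0..1::real}. (x, x) \<in> A})"
    by (rule countably_additive_emeasureI[where N="distr unif borel (\<lambda>x. (x, x))"])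
       (auto simp: emeasure_distr_unif)
  show "countably_additive (sets (grapheur_measure E \<sigma> vs \<theta> vt t)) ?f"
    unfolding sets_grapheur_measure
    by (intro countably_additive_add countably_additive_cmult countably_additive_suminf
        ca1 ca2 ca3 ca4 ca5)
qed (use A in \<open>auto simp: grapheur_measure_def\<close>)

lemma prob_space_grapheur_measure:
  assumes "is_grapheur E \<sigma> vs \<theta> vt"
  shows "prob_space (grapheur_measure E \<sigma> vs \<theta> vt t)"
proof (rule prob_spaceI)
  have "{x. 0 \<le> x \<and> x \<le> 1} = {0..1::real}" by auto
  then show "emeasure (grapheur_measure E \<sigma> vs \<theta> vt t) (space (grapheur_measure E \<sigma> vs \<theta> vt t)) = 1"
    using assms by (simp add: emeasure_grapheur_measure is_grapheur_def emeasure_unit_square)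
qed

lemma sets_iid_uniform [measurable_cong]: "sets iid_uniform = sets (PiM UNIV (\<lambda>_. borel))"
  unfolding iid_uniform_def by (rule sets_PiM_cong) auto

text \<open>The target sigma-algebra is generated by evaluations, so a Borel set \<open>A\<close>
  can be fixed. The delicate terms are the lengths of sections of \<open>A\<close>, which depend
  measurably on the base point.\<close>

lemma measurable_grapheur_measure:
  assumes "is_grapheur E \<sigma> vs \<theta> vt"
  shows "grapheur_measure E \<sigma> vs \<theta> vt \<in> iid_uniform \<rightarrow>\<^sub>M RPM"
proof (intro measurable_prob_algebraI measurable_subprob_algebra)
  fix A :: "(real \<times> real) set" assume A[measurable]: "A \<in> sets borel"
  have A'[measurable]: "A \<in> sets (borel \<Otimes>\<^sub>M borel)"
    using A unfolding borel_prod .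
  have [measurable]: "(\<lambda>x. emeasure lborel {y \<in> {0..1}. (x, y) \<in> A}) \<in> borel_measurable borel"
  proof -
    have "(\<lambda>x. emeasure lborel (Pair x -` (A \<inter> UNIV \<times> {0..1}))) \<in> borel_measurable borel"
      by (rule lborel.measurable_emeasure_Pair) measurable
    moreover have "Pair x -` (A \<inter> UNIV \<times> {0..1}) = {y \<in> {0..1}. (x, y) \<in> A}" for x by auto
    ultimately show ?thesis by simp
  qed
  have [measurable]: "(\<lambda>y. emeasure lborel {x \<in> {0..1}. (x, y) \<in> A}) \<in> borel_measurable borel"
  proof -
    \<comment> \<open>\<open>lborel.measurable_emeasure_Pair\<close> treats sections with the first
      coordinate fixed, so the coordinates are swapped to reach horizontal sections.\<close>
    let ?Q = "{p \<in> space (borel \<Otimes>\<^sub>M lborel). (snd p, fst p) \<in> A \<and> snd p \<in> {0..1}}"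
    have "(\<lambda>y. emeasure lborel (Pair y -` ?Q)) \<in> borel_measurable borel"
      by (rule lborel.measurable_emeasure_Pair) measurable
    moreover have "Pair y -` ?Q = {x \<in> {0..1}. (x, y) \<in> A}" for y
      by (auto simp: space_pair_measure)
    ultimately show ?thesis by simp
  qed
  show "(\<lambda>t. emeasure (grapheur_measure E \<sigma> vs \<theta> vt t) A) \<in> borel_measurable iid_uniform"
    unfolding emeasure_grapheur_measure[OF A] by measurable
qed (use prob_space_grapheur_measure[OF assms] in \<open>auto intro: prob_space_imp_subprob_space\<close>)

section \<open>Maurey sampling of edges\<close>

text \<open>The averaging step of the probabilistic method: if every value exceeded
  \<open>b\<close>, the weighted mean of \<open>g c - b\<close> could be nonpositive only with all
  weights zero.\<close>

lemma weighted_average_witness: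
  fixes p g :: "'c \<Rightarrow> real"
  assumes "finite C" "\<And>c. c \<in> C \<Longrightarrow> 0 \<le> p c" "(\<Sum>c\<in>C. p c) = 1" "(\<Sum>c\<in>C. p c * g c) \<le> b"
  obtains c where "c \<in> C" "g c \<le> b"
proof -
  have "\<exists>c\<in>C. g c \<le> b"
  proof (rule ccontr)
    assume "\<not> (\<exists>c\<in>C. g c \<le> b)"
    then have gt: "\<And>c. c \<in> C \<Longrightarrow> b < g c" by force
    have "(\<Sum>c\<in>C. p c * (g c - b)) = (\<Sum>c\<in>C. p c * g c) - (\<Sum>c\<in>C. p c) * b"
      by (simp add: right_diff_distrib sum_subtractf sum_distrib_right)
    then have "(\<Sum>c\<in>C. p c * (g c - b)) \<le> 0" using assms by simp
    moreover have nn: "\<And>c. c \<in> C \<Longrightarrow> 0 \<le> p c * (g c - b)"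
      using assms(2) gt by (simp add: less_imp_le)
    ultimately have "\<forall>c\<in>C. p c * (g c - b) = 0"
      using sum_nonneg_eq_0_iff[OF assms(1), of "\<lambda>c. p c * (g c - b)"] sum_nonneg[of C "\<lambda>c. p c * (g c - b)"]
      by force
    then have "\<forall>c\<in>C. p c = 0" using gt by fastforce
    then show False using assms(3) by simp
  qed
  then show ?thesis using that by blast
qed

text \<open>A derandomized form of independent sampling from \<open>p\<close>. Indices are picked
  one at a time, possibly with repetition; on average the next index raises the squared deviation by
  at most \<open>B\<close>, so some index does no worse.\<close>

lemma maurey_sampling:
  fixes v :: "'c \<Rightarrow> 'f \<Rightarrow> real"
  assumes fin: "finite C" "finite F"
    and p: "\<And>c. c \<in> C \<Longrightarrow> 0 \<le> p c" "(\<Sum>c\<in>C. p c) = 1"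
    and v: "\<And>c. c \<in> C \<Longrightarrow> (\<Sum>f\<in>F. (v c f)\<^sup>2) \<le> B"
  shows "\<exists>e. (\<forall>l<k. e l \<in> C) \<and>
    (\<Sum>f\<in>F. ((\<Sum>l<k. v (e l) f) - real k * (\<Sum>c\<in>C. p c * v c f))\<^sup>2) \<le> real k * B"
proof (induction k)
  case 0
  then show ?case by simp
next
  case (Suc k)
  define m where "m f = (\<Sum>c\<in>C. p c * v c f)" for f
  obtain e where e: "\<forall>l<k. e l \<in> C"
    and eB: "(\<Sum>f\<in>F. ((\<Sum>l<k. v (e l) f) - real k * m f)\<^sup>2) \<le> real k * B"
    using Suc.IH unfolding m_def by blast
  define W where "W f = (\<Sum>l<k. v (e l) f) - real k * m f" for f
  have "(\<Sum>c\<in>C. p c * (\<Sum>f\<in>F. (W f + v c f - m f)\<^sup>2))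
      = (\<Sum>f\<in>F. \<Sum>c\<in>C. p c * (W f + v c f - m f)\<^sup>2)"
    by (simp add: sum_distrib_left sum.swap[of _ C F])
  \<comment> \<open>With \<open>W\<close> fixed, \<open>v c f - m f\<close> has mean zero under
    \<open>p\<close>. The cross term vanishes and only the variance of the new vector is
    added.\<close>
  also have "\<dots> = (\<Sum>f\<in>F. (W f)\<^sup>2 - (m f)\<^sup>2 + (\<Sum>c\<in>C. p c * (v c f)\<^sup>2))"
  proof (rule sum.cong[OF refl])
    fix f
    have "(\<Sum>c\<in>C. p c * (W f + v c f - m f)\<^sup>2)
        = (\<Sum>c\<in>C. (W f - m f)\<^sup>2 * p c + 2 * (W f - m f) * (p c * v c f) + p c * (v c f)\<^sup>2)"
      by (intro sum.cong refl) (simp add: power2_eq_square algebra_simps)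
    also have "\<dots> = (W f - m f)\<^sup>2 * (\<Sum>c\<in>C. p c) + 2 * (W f - m f) * m f + (\<Sum>c\<in>C. p c * (v c f)\<^sup>2)"
      unfolding m_def by (simp add: sum.distrib sum_distrib_left)
    finally show "(\<Sum>c\<in>C. p c * (W f + v c f - m f)\<^sup>2)
        = (W f)\<^sup>2 - (m f)\<^sup>2 + (\<Sum>c\<in>C. p c * (v c f)\<^sup>2)"
      by (simp add: p(2) power2_eq_square algebra_simps)
  qed
  also have "\<dots> \<le> (\<Sum>f\<in>F. (W f)\<^sup>2) + (\<Sum>f\<in>F. \<Sum>c\<in>C. p c * (v c f)\<^sup>2)"
    unfolding sum.distrib[symmetric] by (intro sum_mono) simp
  also have "(\<Sum>f\<in>F. \<Sum>c\<in>C. p c * (v c f)\<^sup>2) = (\<Sum>c\<in>C. p c * (\<Sum>f\<in>F. (v c f)\<^sup>2))"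
    by (simp add: sum_distrib_left sum.swap[of _ C F])
  also have "\<dots> \<le> (\<Sum>c\<in>C. p c * B)"
    using p v by (intro sum_mono mult_left_mono) auto
  also have "\<dots> = B" using p(2) by (simp add: sum_distrib_right[symmetric])
  finally have "(\<Sum>c\<in>C. p c * (\<Sum>f\<in>F. (W f + v c f - m f)\<^sup>2)) \<le> real (Suc k) * B"
    using eB unfolding W_def[symmetric] by (simp add: algebra_simps)
  from weighted_average_witness[OF fin(1) p this]
  obtain c where c: "c \<in> C" "(\<Sum>f\<in>F. (W f + v c f - m f)\<^sup>2) \<le> real (Suc k) * B" by blast
  have "(\<Sum>l<k. v ((e(k := c)) l) f) = (\<Sum>l<k. v (e l) f)" for f
    by (intro sum.cong) auto
  then have "(\<Sum>l<Suc k. v ((e(k := c)) l) f) - real (Suc k) * m f = W f + v c f - m f" for f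
    by (simp add: W_def algebra_simps)
  then have "(\<Sum>f\<in>F. ((\<Sum>l<Suc k. v ((e(k := c)) l) f) - real (Suc k) * m f)\<^sup>2) \<le> real (Suc k) * B"
    using c(2) by (simp only:)
  moreover have "\<forall>l<Suc k. (e(k := c)) l \<in> C"
    using c(1) e by (simp add: less_Suc_eq)
  ultimately show ?case
    unfolding m_def by blast
qed

text \<open>The coordinates in which the sampled graph must be close to \<open>H\<close>: they are
  the coefficients in the later expansion of the mass of a rectangle. Rows and columns leave out
  loops because a loop depends on a single random point.\<close>

datatype feature = Off | Diag | Row nat | Col nat | Entry "nat \<times> nat"

fun feature_val :: "nat \<times> nat \<Rightarrow> feature \<Rightarrow> real" where
  "feature_val c Off = of_bool (fst c \<noteq> snd c)"
| "feature_val c Diag = of_bool (fst c = snd c)"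
| "feature_val c (Row i) = of_bool (fst c = i \<and> snd c \<noteq> i)"
| "feature_val c (Col j) = of_bool (snd c = j \<and> fst c \<noteq> j)"
| "feature_val c (Entry e) = of_bool (c = e)"

definition features :: "nat \<Rightarrow> feature set" where
  "features p = {Off, Diag} \<union> Row ` {..<p} \<union> Col ` {..<p} \<union> Entry ` ({..<p} \<times> {..<p})"

lemma finite_features: "finite (features p)"
  by (simp add: features_def)

lemma sum_features:
  fixes g :: "feature \<Rightarrow> real"
  shows "(\<Sum>f\<in>features p. g f) = g Off + g Diag + (\<Sum>i<p. g (Row i)) + (\<Sum>j<p. g (Col j))
    + (\<Sum>e\<in>{..<p} \<times> {..<p}. g (Entry e))"
proof -
  have "sum g (features p) = sum g {Off, Diag} + sum g (Row ` {..<p}) + sum g (Col ` {..<p})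
      + sum g (Entry ` ({..<p} \<times> {..<p}))"
    unfolding features_def by (subst sum.union_disjoint, simp, simp, blast)+ simp
  then show ?thesis
    by (simp add: sum.reindex inj_on_def)
qed

text \<open>An edge that is not a loop has exactly four nonzero features, namely \<open>Off\<close>,
  its row, its column and its entry. A loop has only \<open>Diag\<close> and its entry.\<close>

lemma sum_feature_val_le:
  assumes "c \<in> {..<p} \<times> {..<p}"
  shows "(\<Sum>f\<in>features p. (feature_val c f)\<^sup>2) \<le> 4"
proof -
  have *: "(of_bool P :: real)\<^sup>2 = of_bool P" for P by simp
  have "(\<Sum>i<p. of_bool (fst c = i \<and> snd c \<noteq> i) :: real) \<le> (\<Sum>i<p. if i = fst c then 1 else 0)"
    "(\<Sum>j<p. of_bool (snd c = j \<and> fst c \<noteq> j) :: real) \<le> (\<Sum>j<p. if j = snd c then 1 else 0)"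
    by (intro sum_mono; simp)+
  moreover have "(\<Sum>e\<in>{..<p} \<times> {..<p}. of_bool (c = e) :: real) = (\<Sum>e\<in>{..<p} \<times> {..<p}. if e = c then 1 else 0)"
    by (intro sum.cong) auto
  ultimately show ?thesis
    using assms by (auto simp: sum_features * simp del: sum_of_bool_eq)
qed

text \<open>Edges are sampled with probabilities \<open>H\<close>. The squared deviation
  \<open>4 * k\<close> of the counts becomes \<open>4 / k\<close> after normalizing the counts by
  \<open>k\<close>.\<close>

lemma sparse_graph_sampling:
  fixes H :: "nat \<times> nat \<Rightarrow> real"
  assumes H: "\<And>c. c \<in> {..<p} \<times> {..<p} \<Longrightarrow> 0 \<le> H c" "(\<Sum>c\<in>{..<p} \<times> {..<p}. H c) = 1" and k: "k > 0"
  obtains e :: "nat \<Rightarrow> nat \<times> nat" where "\<And>l. l < k \<Longrightarrow> e l \<in> {..<p} \<times> {..<p}"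
    "(\<Sum>f\<in>features p. (\<Sum>c\<in>{..<p} \<times> {..<p}.
        (real (card {l. l < k \<and> e l = c}) / real k - H c) * feature_val c f)\<^sup>2) \<le> 4 / real k"
proof -
  let ?C = "{..<p} \<times> {..<p}"
  obtain e where e: "\<forall>l<k. e l \<in> ?C"
    and b: "(\<Sum>f\<in>features p. ((\<Sum>l<k. feature_val (e l) f) - real k * (\<Sum>c\<in>?C. H c * feature_val c f))\<^sup>2) \<le> real k * 4"
    using maurey_sampling[of ?C "features p" H feature_val 4 k, OF _ finite_features H sum_feature_val_le]
    by auto
  define D where "D c = real (card {l. l < k \<and> e l = c}) / real k - H c" for c
  \<comment> \<open>The chosen edges are grouped by the pair they equal, so multiplicities turn into
    weights.\<close>
  have "(\<Sum>l<k. feature_val (e l) f) = (\<Sum>c\<in>?C. real (card {l. l < k \<and> e l = c}) * feature_val c f)" for f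
  proof -
    have "(\<Sum>l<k. feature_val (e l) f) = (\<Sum>c\<in>?C. \<Sum>l | l \<in> {..<k} \<and> e l = c. feature_val (e l) f)"
      using e by (subst sum.group) auto
    also have "\<dots> = (\<Sum>c\<in>?C. real (card {l. l < k \<and> e l = c}) * feature_val c f)"
      by (intro sum.cong refl) simp
    finally show ?thesis .
  qed
  then have "(\<Sum>l<k. feature_val (e l) f) - real k * (\<Sum>c\<in>?C. H c * feature_val c f)
      = real k * (\<Sum>c\<in>?C. D c * feature_val c f)" for f
    using k by (simp add: D_def sum_distrib_left sum_subtractf[symmetric] algebra_simps)
  then have "(real k)\<^sup>2 * (\<Sum>f\<in>features p. (\<Sum>c\<in>?C. D c * feature_val c f)\<^sup>2) \<le> real k * 4"
    using b by (simp only: power_mult_distrib sum_distrib_left[symmetric])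
  then have "(\<Sum>f\<in>features p. (\<Sum>c\<in>?C. D c * feature_val c f)\<^sup>2) \<le> 4 / real k"
    using k by (simp add: field_simps power2_eq_square)
  then show ?thesis using that e unfolding D_def by blast
qed

section \<open>Second moments under iid uniform points\<close>

interpretation iid: prob_space iid_uniform
  unfolding iid_uniform_def by (intro prob_space_PiM prob_space_unif)

interpretation unif: prob_space unif
  by (rule prob_space_unif)

lemma space_iid_uniform [simp]: "space iid_uniform = UNIV"
  using sets_eq_imp_space_eq[OF sets_iid_uniform] by (simp add: space_PiM)

text \<open>The integrand depends only on the coordinates in \<open>J\<close>. Their joint law is a
  finite product measure, where integrals of products factor.\<close>

lemma integral_iid_uniform_prod:
  fixes f :: "nat \<Rightarrow> real \<Rightarrow> real"
  assumes J: "finite J" and f: "\<And>v. v \<in> J \<Longrightarrow> integrable unif (f v)"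
  shows "(\<integral>\<omega>. (\<Prod>v\<in>J. f v (\<omega> v)) \<partial>iid_uniform) = (\<Prod>v\<in>J. \<integral>x. f v x \<partial>unif)"
proof -
  interpret P: product_prob_space "\<lambda>_. unif" "UNIV :: nat set"
    by unfold_locales
  have [measurable]: "f v \<in> borel_measurable unif" if "v \<in> J" for v
    using f[OF that] by simp
  have m: "(\<lambda>x. \<Prod>v\<in>J. f v (x v)) \<in> borel_measurable (PiM J (\<lambda>_. unif))"
    by measurable
  have "(\<Prod>v\<in>J. \<integral>x. f v x \<partial>unif) = (\<integral>x. (\<Prod>v\<in>J. f v (x v)) \<partial>PiM J (\<lambda>_. unif))"
    using P.product_integral_prod[OF J f] by simp
  also have "PiM J (\<lambda>_. unif) = distr iid_uniform (PiM J (\<lambda>_. unif)) (\<lambda>x. restrict x J)"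
    unfolding iid_uniform_def using P.distr_PiM_restrict_finite[OF J] by simp
  also have "(\<integral>x. (\<Prod>v\<in>J. f v (x v)) \<partial>\<dots>) = (\<integral>x. (\<Prod>v\<in>J. f v (restrict x J v)) \<partial>iid_uniform)"
    by (rule integral_distr[OF _ m]) (auto simp: iid_uniform_def intro: measurable_restrict_subset)
  also have "\<dots> = (\<integral>\<omega>. (\<Prod>v\<in>J. f v (\<omega> v)) \<partial>iid_uniform)"
    by (intro Bochner_Integration.integral_cong refl prod.cong) auto
  finally show ?thesis by simp
qed

text \<open>The bound 1 holds everywhere and survives multiplication, so products of such functions
  of the coordinates are integrable with second moment at most 1.\<close>

definition unit_bounded :: "(real \<Rightarrow> real) \<Rightarrow> bool" where
  "unit_bounded f \<longleftrightarrow> f \<in> borel_measurable borel \<and> (\<forall>x. \<bar>f x\<bar> \<le> 1)"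

text \<open>The coordinate \<open>i\<close> occurs in a single factor, so by independence its zero
  mean splits off. The other three indices may coincide with one another.\<close>

lemma integral_centered_mult_eq_0:
  assumes f: "unit_bounded f1" "unit_bounded f2" "unit_bounded f3" "unit_bounded f4"
    and i: "i \<noteq> j" "i \<noteq> j'" "i \<noteq> j''" and c: "(\<integral>x. f1 x \<partial>unif) = 0"
  shows "(\<integral>\<omega>. f1 (\<omega> i) * f2 (\<omega> j) * f3 (\<omega> j') * f4 (\<omega> j'') \<partial>iid_uniform) = 0"
proof -
  define J where "J = {i, j, j', j''}"
  \<comment> \<open>\<open>h v\<close> gathers all factors evaluated at coordinate \<open>v\<close>.
    This absorbs coincidences among \<open>j\<close>, \<open>j'\<close> and \<open>j''\<close> and
    leaves one factor for each element of \<open>J\<close>.\<close>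
  define h where "h v x = (if v = i then f1 x else 1) * (if v = j then f2 x else 1)
    * (if v = j' then f3 x else 1) * (if v = j'' then f4 x else 1)" for v x
  have J: "finite J" by (simp add: J_def)
  have [measurable]: "f1 \<in> borel_measurable borel" "f2 \<in> borel_measurable borel"
    "f3 \<in> borel_measurable borel" "f4 \<in> borel_measurable borel"
    using f by (auto simp: unit_bounded_def)
  have b: "\<bar>f1 x\<bar> \<le> 1" "\<bar>f2 x\<bar> \<le> 1" "\<bar>f3 x\<bar> \<le> 1" "\<bar>f4 x\<bar> \<le> 1" for x
    using f by (auto simp: unit_bounded_def)
  have prod_h: "(\<Prod>v\<in>J. h v (\<omega> v)) = f1 (\<omega> i) * f2 (\<omega> j) * f3 (\<omega> j') * f4 (\<omega> j'')" for \<omega>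
  proof -
    have "(\<Prod>v\<in>J. if v = w then g (\<omega> v) else 1) = g (\<omega> w)" if "w \<in> J" for w and g :: "real \<Rightarrow> real"
      using prod.delta'[OF J, of w "\<lambda>v. g (\<omega> v)"] prod.delta[OF J, of w "\<lambda>v. g (\<omega> v)"] that by simp
    then show ?thesis
      unfolding h_def prod.distrib by (simp add: J_def)
  qed
  have "integrable unif (h v)" for v
  proof (rule unif.integrable_const_bound[where B=1])
    show "h v \<in> borel_measurable unif" unfolding h_def by measurable
    show "AE x in unif. norm (h v x) \<le> 1"
      unfolding h_def real_norm_def abs_mult
      by (intro AE_I2 mult_le_one mult_nonneg_nonneg) (auto simp: b)
  qed
  then have "(\<integral>\<omega>. (\<Prod>v\<in>J. h v (\<omega> v)) \<partial>iid_uniform) = (\<Prod>v\<in>J. \<integral>x. h v x \<partial>unif)"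
    by (intro integral_iid_uniform_prod J)
  also have "\<dots> = 0"
  proof (rule prod_zero[OF J])
    show "\<exists>a\<in>J. (\<integral>x. h a x \<partial>unif) = 0"
      using i c by (intro bexI[of _ i]) (auto simp: h_def J_def)
  qed
  finally show ?thesis by (simp only: prod_h)
qed

text \<open>Pythagoras: in the expanded square the mixed terms vanish, and each diagonal term is at
  most \<open>(R i)^2\<close> because \<open>Y i\<close> is bounded by 1.\<close>

lemma (in prob_space) expectation_orthogonal_sum_sq_le:
  fixes Y :: "'i \<Rightarrow> 'a \<Rightarrow> real"
  assumes I: "finite I" and Y[measurable]: "\<And>i. i \<in> I \<Longrightarrow> Y i \<in> borel_measurable M"
    and b: "\<And>i x. i \<in> I \<Longrightarrow> \<bar>Y i x\<bar> \<le> 1"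
    and o: "\<And>i j. i \<in> I \<Longrightarrow> j \<in> I \<Longrightarrow> i \<noteq> j \<Longrightarrow> expectation (\<lambda>x. Y i x * Y j x) = 0"
  shows "expectation (\<lambda>x. (\<Sum>i\<in>I. R i * Y i x)\<^sup>2) \<le> (\<Sum>i\<in>I. (R i)\<^sup>2)"
proof -
  have int: "integrable M (\<lambda>x. Y i x * Y j x)" if "i \<in> I" "j \<in> I" for i j
    using that by (intro integrable_const_bound[where B=1]) (auto simp: abs_mult b intro!: mult_le_one)
  have sq: "(\<Sum>i\<in>I. R i * Y i x)\<^sup>2 = (\<Sum>i\<in>I. \<Sum>j\<in>I. R i * R j * (Y i x * Y j x))" for x
    by (simp add: power2_eq_square sum_product mult_ac)
  have "expectation (\<lambda>x. (\<Sum>i\<in>I. R i * Y i x)\<^sup>2) = (\<Sum>i\<in>I. \<Sum>j\<in>I. R i * R j * expectation (\<lambda>x. Y i x * Y j x))"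
    unfolding sq using int by (simp add: Bochner_Integration.integral_sum)
  also have "\<dots> = (\<Sum>i\<in>I. \<Sum>j\<in>I. if j = i then (R i)\<^sup>2 * expectation (\<lambda>x. (Y i x)\<^sup>2) else 0)"
    using o by (intro sum.cong refl) (auto simp: power2_eq_square)
  also have "\<dots> = (\<Sum>i\<in>I. (R i)\<^sup>2 * expectation (\<lambda>x. (Y i x)\<^sup>2))"
    using I by simp
  also have "\<dots> \<le> (\<Sum>i\<in>I. (R i)\<^sup>2 * 1)"
  proof (intro sum_mono mult_left_mono)
    fix i assume i: "i \<in> I"
    have "expectation (\<lambda>x. (Y i x)\<^sup>2) \<le> expectation (\<lambda>x. 1)"
      using i int[OF i i] b[OF i] by (intro integral_mono) (auto simp: power2_eq_square abs_square_le_1[unfolded power2_eq_square])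
    then show "expectation (\<lambda>x. (Y i x)\<^sup>2) \<le> 1" by (simp add: prob_space)
  qed auto
  finally show ?thesis by simp
qed

text \<open>Passes from second to first moments by integrating the pointwise AM-GM bound
  \<open>\<bar>X x\<bar> \<le> (X x)^2 / (2 * q) + q / 2\<close>.\<close>

lemma (in prob_space) expectation_abs_le:
  fixes X :: "'a \<Rightarrow> real"
  assumes "integrable M X" "integrable M (\<lambda>x. (X x)\<^sup>2)" "expectation (\<lambda>x. (X x)\<^sup>2) \<le> q\<^sup>2" "q > 0"
  shows "expectation (\<lambda>x. \<bar>X x\<bar>) \<le> q"
proof -
  have "\<bar>X x\<bar> \<le> (X x)\<^sup>2 / (2 * q) + q / 2" for x
  proof -
    have "0 \<le> (\<bar>X x\<bar> - q)\<^sup>2" by simp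
    then have "2 * q * \<bar>X x\<bar> \<le> (X x)\<^sup>2 + q\<^sup>2" by (simp add: power2_diff mult_ac)
    then show ?thesis using assms(4) by (simp add: field_simps power2_eq_square)
  qed
  then have "expectation (\<lambda>x. \<bar>X x\<bar>) \<le> expectation (\<lambda>x. (X x)\<^sup>2 / (2 * q) + q / 2)"
    using assms by (intro integral_mono) auto
  also have "\<dots> = expectation (\<lambda>x. (X x)\<^sup>2) / (2 * q) + q / 2"
    using assms(2) by (simp add: prob_space)
  also have "\<dots> \<le> q\<^sup>2 / (2 * q) + q / 2"
    using assms by (intro add_right_mono divide_right_mono) auto
  also have "\<dots> = q" using assms(4) by (simp add: field_simps power2_eq_square)
  finally show ?thesis .
qed

section \<open>Centred indicators\<close>

definition centered :: "real set \<Rightarrow> real \<Rightarrow> real" where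
  "centered S x = indicator S x - measure unif S"

lemma unit_bounded_centered:
  assumes [measurable]: "S \<in> sets borel"
  shows "unit_bounded (centered S)"
proof -
  have "0 \<le> measure unif S" "measure unif S \<le> 1"
    by (simp_all del: measure_uniform_measure)
  then have "\<bar>indicator S x - measure unif S\<bar> \<le> 1" for x
    by (auto simp: indicator_def simp del: measure_uniform_measure)
  then show ?thesis
    unfolding unit_bounded_def centered_def by auto
qed

lemma integral_centered:
  assumes [measurable]: "S \<in> sets borel"
  shows "(\<integral>x. centered S x \<partial>unif) = 0"
proof -
  have "(\<integral>x. indicator S x \<partial>unif) = measure unif S"
    by (subst Bochner_Integration.integral_indicator) auto
  then show ?thesis
    unfolding centered_def using unif.prob_space
    by (subst Bochner_Integration.integral_diff)
       (auto simp: intro!: unif.integrable_const_bound[where B=1])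
qed

lemma square_add_le: "(x + y)\<^sup>2 \<le> 2 * x\<^sup>2 + 2 * (y::real)\<^sup>2"
  using sum_squares_bound[of x y] by (simp add: power2_sum)

lemma (in prob_space) integrable_bounded_sum:
  fixes Y :: "'i \<Rightarrow> 'a \<Rightarrow> real"
  assumes Y[measurable]: "\<And>i. i \<in> I \<Longrightarrow> Y i \<in> borel_measurable M"
    and b: "\<And>i x. i \<in> I \<Longrightarrow> \<bar>Y i x\<bar> \<le> 1"
  shows "integrable M (\<lambda>x. \<Sum>i\<in>I. R i * Y i x)"
    and "integrable M (\<lambda>x. (\<Sum>i\<in>I. R i * Y i x)\<^sup>2)"
proof -
  have le: "\<bar>\<Sum>i\<in>I. R i * Y i x\<bar> \<le> (\<Sum>i\<in>I. \<bar>R i\<bar>)" for x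
    using b by (intro order_trans[OF sum_abs] sum_mono) (simp add: abs_mult mult_left_le)
  have m: "(\<lambda>x. \<Sum>i\<in>I. R i * Y i x) \<in> borel_measurable M"
    by measurable
  show "integrable M (\<lambda>x. \<Sum>i\<in>I. R i * Y i x)"
    using le m by (intro integrable_const_bound[where B="\<Sum>i\<in>I. \<bar>R i\<bar>"]) auto
  have "(\<Sum>i\<in>I. R i * Y i x)\<^sup>2 \<le> (\<Sum>i\<in>I. \<bar>R i\<bar>)\<^sup>2" for x
    using power_mono[OF le, of x 2] by simp
  then show "integrable M (\<lambda>x. (\<Sum>i\<in>I. R i * Y i x)\<^sup>2)"
    using m by (intro integrable_const_bound[where B="(\<Sum>i\<in>I. \<bar>R i\<bar>)\<^sup>2"]) auto
qed

lemma measurable_unit_bounded_component: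
  "unit_bounded f \<Longrightarrow> (\<lambda>\<omega>. f (\<omega> i)) \<in> borel_measurable iid_uniform"
proof -
  assume "unit_bounded f"
  then have [measurable]: "f \<in> borel_measurable borel" by (simp add: unit_bounded_def)
  show ?thesis by measurable
qed

lemma unit_bounded_const: "unit_bounded (\<lambda>_. 1)"
  by (simp add: unit_bounded_def)

text \<open>Centred functions of distinct coordinates are orthogonal. This is the four-factor
  identity with two factors equal to 1.\<close>

lemma linear_discrepancy_le:
  assumes f: "unit_bounded f" "(\<integral>x. f x \<partial>unif) = 0" and I: "finite I"
  shows "iid.expectation (\<lambda>\<omega>. (\<Sum>i\<in>I. R i * f (\<omega> i))\<^sup>2) \<le> (\<Sum>i\<in>I. (R i)\<^sup>2)"
proof (rule iid.expectation_orthogonal_sum_sq_le[OF I])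
  show "iid.expectation (\<lambda>\<omega>. f (\<omega> i) * f (\<omega> j)) = 0" if "i \<noteq> j" for i j
    using integral_centered_mult_eq_0[OF f(1) f(1) unit_bounded_const unit_bounded_const, of i j j j] that f(2)
    by simp
qed (use f in \<open>auto simp: unit_bounded_def intro!: measurable_unit_bounded_component\<close>)

text \<open>Two products are orthogonal once some index occurs in only one factor. Among distinct
  pairs without loops this fails only for a pair and its reversal, so \<open>I\<close> may not
  contain both.\<close>

lemma quadratic_discrepancy_le:
  assumes f: "unit_bounded f" "(\<integral>x. f x \<partial>unif) = 0"
    and g: "unit_bounded g" "(\<integral>x. g x \<partial>unif) = 0"
    and I: "finite I" "\<And>c. c \<in> I \<Longrightarrow> fst c \<noteq> snd c" "\<And>c. c \<in> I \<Longrightarrow> prod.swap c \<notin> I"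
  shows "iid.expectation (\<lambda>\<omega>. (\<Sum>c\<in>I. R c * (f (\<omega> (fst c)) * g (\<omega> (snd c))))\<^sup>2) \<le> (\<Sum>c\<in>I. (R c)\<^sup>2)"
proof (rule iid.expectation_orthogonal_sum_sq_le[OF I(1)])
  fix c d assume cd: "c \<in> I" "d \<in> I" "c \<noteq> d"
  obtain i j where c: "c = (i, j)" by force
  obtain k l where d: "d = (k, l)" by force
  have ne: "i \<noteq> j" "k \<noteq> l" using I(2) cd c d by force+
  have "\<not> (i = l \<and> j = k)" using I(3)[OF cd(1)] cd c d by auto
  \<comment> \<open>If \<open>i\<close> and \<open>j\<close> both lay in \<open>{k, l}\<close>, then
    \<open>(i, j)\<close> would be \<open>(k, l)\<close> or \<open>(l, k)\<close>, and both are
    excluded.\<close>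
  then consider "i \<notin> {j, k, l}" | "j \<notin> {i, k, l}"
    using ne cd c d by auto
  then have "iid.expectation (\<lambda>\<omega>. f (\<omega> i) * g (\<omega> j) * (f (\<omega> k) * g (\<omega> l))) = 0"
  proof cases
    case 1
    then show ?thesis
      using integral_centered_mult_eq_0[OF f(1) g(1) f(1) g(1), of i j k l] f(2) by (simp add: mult_ac)
  next
    case 2
    then show ?thesis
      using integral_centered_mult_eq_0[OF g(1) f(1) f(1) g(1), of j i k l] g(2) by (simp add: mult_ac)
  qed
  then show "iid.expectation (\<lambda>\<omega>. f (\<omega> (fst c)) * g (\<omega> (snd c)) * (f (\<omega> (fst d)) * g (\<omega> (snd d)))) = 0"
    by (simp add: c d)
qed (use f g in \<open>auto simp: unit_bounded_def abs_mult intro!: mult_le_one borel_measurable_times measurable_unit_bounded_component\<close>)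

text \<open>Off the diagonal the product of indicators is \<open>(s + a) * (t + b)\<close> with
  \<open>a\<close> and \<open>b\<close> centred; at a loop it is the indicator of
  \<open>S \<inter> T\<close>, that is \<open>r + z\<close>. Multiplying out and summing against
  \<open>D\<close> gives seven sums \<open>X1\<close> to \<open>X7\<close> whose coefficients are
  features of \<open>D\<close>, up to factors in [0,1].\<close>

lemma graph_discrepancy_sq_le:
  fixes D :: "nat \<times> nat \<Rightarrow> real"
  assumes S[measurable]: "S \<in> sets borel" and T[measurable]: "T \<in> sets borel"
  shows "iid.expectation (\<lambda>\<omega>. (\<Sum>c\<in>{..<p} \<times> {..<p}. D c * (indicator S (\<omega> (fst c)) * indicator T (\<omega> (snd c))))\<^sup>2)
    \<le> 8 * (\<Sum>f\<in>features p. (\<Sum>c\<in>{..<p} \<times> {..<p}. D c * feature_val c f)\<^sup>2)"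
proof -
  define C where "C = {..<p} \<times> {..<p}"
  have C: "finite C" by (simp add: C_def)
  define \<Phi> where "\<Phi> f = (\<Sum>c\<in>C. D c * feature_val c f)" for f
  define s t r where "s = measure unif S" and "t = measure unif T" and "r = measure unif (S \<inter> T)"
  have str: "0 \<le> s" "s \<le> 1" "0 \<le> t" "t \<le> 1" "0 \<le> r" "r \<le> 1"
    unfolding s_def t_def r_def by (simp_all del: measure_uniform_measure)
  define a b z where "a = centered S" and "b = centered T" and "z = centered (S \<inter> T)"
  have bb: "unit_bounded a" "unit_bounded b" "unit_bounded z"
    unfolding a_def b_def z_def by (auto intro!: unit_bounded_centered)
  have i0: "(\<integral>x. a x \<partial>unif) = 0" "(\<integral>x. b x \<partial>unif) = 0" "(\<integral>x. z x \<partial>unif) = 0"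
    unfolding a_def b_def z_def by (auto intro!: integral_centered)
  \<comment> \<open>The bilinear part is split into the two strict triangles because neither
    contains a pair together with its reversal.\<close>
  define L U where "L = {c \<in> C. fst c < snd c}" and "U = {c \<in> C. snd c < fst c}"
  have LU: "finite L" "finite U" "L \<subseteq> C" "U \<subseteq> C" "L \<inter> U = {}" by (auto simp: L_def U_def C)
  define X1 where "X1 = s * t * \<Phi> Off"
  define X2 where "X2 = r * \<Phi> Diag"
  define X3 where "X3 \<omega> = (\<Sum>i<p. (t * \<Phi> (Row i)) * a (\<omega> i))" for \<omega> :: "nat \<Rightarrow> real"
  define X4 where "X4 \<omega> = (\<Sum>i<p. (s * \<Phi> (Col i)) * b (\<omega> i))" for \<omega> :: "nat \<Rightarrow> real"
  define X5 where "X5 \<omega> = (\<Sum>i<p. D (i, i) * z (\<omega> i))" for \<omega> :: "nat \<Rightarrow> real"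
  define X6 where "X6 \<omega> = (\<Sum>c\<in>L. D c * (a (\<omega> (fst c)) * b (\<omega> (snd c))))" for \<omega> :: "nat \<Rightarrow> real"
  define X7 where "X7 \<omega> = (\<Sum>c\<in>U. D c * (a (\<omega> (fst c)) * b (\<omega> (snd c))))" for \<omega> :: "nat \<Rightarrow> real"
  define X where "X \<omega> = (\<Sum>c\<in>C. D c * (indicator S (\<omega> (fst c)) * indicator T (\<omega> (snd c))))" for \<omega> :: "nat \<Rightarrow> real"
  have decomp: "X \<omega> = ((X1 + X2) + (X3 \<omega> + X4 \<omega>)) + ((X6 \<omega> + X7 \<omega>) + X5 \<omega>)" for \<omega>
  proof -
    \<comment> \<open>Interchanging the sums undoes the row sums: for a fixed edge only
      \<open>i = fst c\<close> contributes. Columns are treated alike with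
      \<open>snd c\<close>.\<close>
    have x3: "X3 \<omega> = (\<Sum>c\<in>C. D c * (t * of_bool (fst c \<noteq> snd c) * a (\<omega> (fst c))))"
    proof -
      have "X3 \<omega> = (\<Sum>c\<in>C. \<Sum>i<p. D c * (t * feature_val c (Row i) * a (\<omega> i)))"
        unfolding X3_def \<Phi>_def
        by (subst sum.swap) (simp add: sum_distrib_left sum_distrib_right mult_ac)
      also have "\<dots> = (\<Sum>c\<in>C. D c * (t * of_bool (fst c \<noteq> snd c) * a (\<omega> (fst c))))"
      proof (rule sum.cong[OF refl])
        fix c assume "c \<in> C"
        then have "fst c < p" by (auto simp: C_def)
        have "(\<Sum>i<p. D c * (t * feature_val c (Row i) * a (\<omega> i)))
          = (\<Sum>i<p. if i = fst c then D c * (t * of_bool (fst c \<noteq> snd c) * a (\<omega> i)) else 0)"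
          by (intro sum.cong) auto
        also have "\<dots> = D c * (t * of_bool (fst c \<noteq> snd c) * a (\<omega> (fst c)))"
          using \<open>fst c < p\<close> by simp
        finally show "(\<Sum>i<p. D c * (t * feature_val c (Row i) * a (\<omega> i)))
          = D c * (t * of_bool (fst c \<noteq> snd c) * a (\<omega> (fst c)))" .
      qed
      finally show ?thesis .
    qed
    have x4: "X4 \<omega> = (\<Sum>c\<in>C. D c * (s * of_bool (fst c \<noteq> snd c) * b (\<omega> (snd c))))"
    proof -
      have "X4 \<omega> = (\<Sum>c\<in>C. \<Sum>i<p. D c * (s * feature_val c (Col i) * b (\<omega> i)))"
        unfolding X4_def \<Phi>_def
        by (subst sum.swap) (simp add: sum_distrib_left sum_distrib_right mult_ac)
      also have "\<dots> = (\<Sum>c\<in>C. D c * (s * of_bool (fst c \<noteq> snd c) * b (\<omega> (snd c))))"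
      proof (rule sum.cong[OF refl])
        fix c assume "c \<in> C"
        then have "snd c < p" by (auto simp: C_def)
        have "(\<Sum>i<p. D c * (s * feature_val c (Col i) * b (\<omega> i)))
          = (\<Sum>i<p. if i = snd c then D c * (s * of_bool (fst c \<noteq> snd c) * b (\<omega> i)) else 0)"
          by (intro sum.cong) auto
        also have "\<dots> = D c * (s * of_bool (fst c \<noteq> snd c) * b (\<omega> (snd c)))"
          using \<open>snd c < p\<close> by simp
        finally show "(\<Sum>i<p. D c * (s * feature_val c (Col i) * b (\<omega> i)))
          = D c * (s * of_bool (fst c \<noteq> snd c) * b (\<omega> (snd c)))" .
      qed
      finally show ?thesis .
    qed
    have x5: "X5 \<omega> = (\<Sum>c\<in>C. D c * (of_bool (fst c = snd c) * z (\<omega> (fst c))))"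
    proof -
      have "(\<Sum>c\<in>C. D c * (of_bool (fst c = snd c) * z (\<omega> (fst c))))
        = (\<Sum>i<p. \<Sum>j<p. if j = i then D (i, i) * z (\<omega> i) else 0)"
        unfolding C_def sum.cartesian_product by (intro sum.cong) auto
      then show ?thesis by (simp add: X5_def)
    qed
    have x6: "X6 \<omega> = (\<Sum>c\<in>C. D c * (of_bool (fst c < snd c) * (a (\<omega> (fst c)) * b (\<omega> (snd c)))))"
      unfolding X6_def L_def using C
      by (subst sum.inter_filter) (auto intro!: sum.cong)
    have x7: "X7 \<omega> = (\<Sum>c\<in>C. D c * (of_bool (snd c < fst c) * (a (\<omega> (fst c)) * b (\<omega> (snd c)))))"
      unfolding X7_def U_def using C
      by (subst sum.inter_filter) (auto intro!: sum.cong)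
    have x1: "X1 = (\<Sum>c\<in>C. D c * (s * t * of_bool (fst c \<noteq> snd c)))"
      unfolding X1_def \<Phi>_def by (simp add: sum_distrib_left mult_ac)
    have x2: "X2 = (\<Sum>c\<in>C. D c * (r * of_bool (fst c = snd c)))"
      unfolding X2_def \<Phi>_def by (simp add: sum_distrib_left mult_ac)
    \<comment> \<open>All seven sums now run over \<open>C\<close>, so the identity can be checked
      edge by edge.\<close>
    show ?thesis
      unfolding x1 x2 x3 x4 x5 x6 x7 X_def sum.distrib[symmetric] distrib_left[symmetric]
    proof (intro sum.cong refl arg_cong[where f="\<lambda>y. D _ * y"])
      fix c
      have S: "indicator S (\<omega> (fst c)) = s + a (\<omega> (fst c))"
        and T: "indicator T (\<omega> (snd c)) = t + b (\<omega> (snd c))"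
        and ST: "indicator S (\<omega> (fst c)) * indicator T (\<omega> (fst c)) = r + z (\<omega> (fst c))"
        by (simp_all add: a_def b_def z_def centered_def s_def t_def r_def indicator_inter_arith del: measure_uniform_measure)
      consider "fst c = snd c" | "fst c < snd c" | "snd c < fst c" by linarith
      then show "indicator S (\<omega> (fst c)) * indicator T (\<omega> (snd c)) =
         s * t * of_bool (fst c \<noteq> snd c) + r * of_bool (fst c = snd c) +
         (t * of_bool (fst c \<noteq> snd c) * a (\<omega> (fst c)) + s * of_bool (fst c \<noteq> snd c) * b (\<omega> (snd c))) +
         (of_bool (fst c < snd c) * (a (\<omega> (fst c)) * b (\<omega> (snd c))) +
          of_bool (snd c < fst c) * (a (\<omega> (fst c)) * b (\<omega> (snd c))) +
          of_bool (fst c = snd c) * z (\<omega> (fst c)))"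
      proof cases
        case 1
        then show ?thesis using ST by simp
      qed (simp_all add: S T algebra_simps)
    qed
  qed
  have int: "integrable iid_uniform (\<lambda>\<omega>. (X3 \<omega>)\<^sup>2)" "integrable iid_uniform (\<lambda>\<omega>. (X4 \<omega>)\<^sup>2)"
    "integrable iid_uniform (\<lambda>\<omega>. (X5 \<omega>)\<^sup>2)" "integrable iid_uniform (\<lambda>\<omega>. (X6 \<omega>)\<^sup>2)"
    "integrable iid_uniform (\<lambda>\<omega>. (X7 \<omega>)\<^sup>2)"
    unfolding X3_def X4_def X5_def X6_def X7_def
    using bb by (auto simp: unit_bounded_def abs_mult intro!: iid.integrable_bounded_sum mult_le_one
        borel_measurable_times measurable_unit_bounded_component)
  have intX: "integrable iid_uniform (\<lambda>\<omega>. (X \<omega>)\<^sup>2)"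
    unfolding X_def
    by (rule iid.integrable_bounded_sum) (auto simp: indicator_def)
  \<comment> \<open>Three nested uses of \<open>square_add_le\<close> give the factor 8. In the
    grouping of \<open>decomp\<close>, \<open>X5\<close> sits one level higher and gets only 4,
    which is raised to 8 by nonnegativity.\<close>
  have "(X \<omega>)\<^sup>2 \<le> 8 * (X1\<^sup>2 + X2\<^sup>2 + (X3 \<omega>)\<^sup>2 + (X4 \<omega>)\<^sup>2 + (X5 \<omega>)\<^sup>2 + (X6 \<omega>)\<^sup>2 + (X7 \<omega>)\<^sup>2)" for \<omega>
    using square_add_le[of "(X1 + X2) + (X3 \<omega> + X4 \<omega>)" "(X6 \<omega> + X7 \<omega>) + X5 \<omega>"]
      square_add_le[of "X1 + X2" "X3 \<omega> + X4 \<omega>"] square_add_le[of "X6 \<omega> + X7 \<omega>" "X5 \<omega>"]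
      square_add_le[of X1 X2] square_add_le[of "X3 \<omega>" "X4 \<omega>"] square_add_le[of "X6 \<omega>" "X7 \<omega>"]
      zero_le_power2[of "X5 \<omega>"]
    unfolding decomp distrib_left by linarith
  then have "iid.expectation (\<lambda>\<omega>. (X \<omega>)\<^sup>2) \<le> iid.expectation (\<lambda>\<omega>.
      8 * (X1\<^sup>2 + X2\<^sup>2 + (X3 \<omega>)\<^sup>2 + (X4 \<omega>)\<^sup>2 + (X5 \<omega>)\<^sup>2 + (X6 \<omega>)\<^sup>2 + (X7 \<omega>)\<^sup>2))"
    using int intX by (intro integral_mono) auto
  also have "\<dots> = 8 * (X1\<^sup>2 + X2\<^sup>2 + iid.expectation (\<lambda>\<omega>. (X3 \<omega>)\<^sup>2) + iid.expectation (\<lambda>\<omega>. (X4 \<omega>)\<^sup>2)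
      + iid.expectation (\<lambda>\<omega>. (X5 \<omega>)\<^sup>2) + iid.expectation (\<lambda>\<omega>. (X6 \<omega>)\<^sup>2) + iid.expectation (\<lambda>\<omega>. (X7 \<omega>)\<^sup>2))"
    using int iid.prob_space by simp
  also have "\<dots> \<le> 8 * ((\<Phi> Off)\<^sup>2 + (\<Phi> Diag)\<^sup>2 + (\<Sum>i<p. (\<Phi> (Row i))\<^sup>2) + (\<Sum>i<p. (\<Phi> (Col i))\<^sup>2)
      + (\<Sum>i<p. (D (i, i))\<^sup>2) + (\<Sum>c\<in>L. (D c)\<^sup>2) + (\<Sum>c\<in>U. (D c)\<^sup>2))"
  proof (intro mult_left_mono add_mono)
    \<comment> \<open>The means \<open>s\<close>, \<open>t\<close>, \<open>r\<close> lie in [0,1],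
      so as factors they can only shrink squares.\<close>
    have sc: "(x * y)\<^sup>2 \<le> y\<^sup>2" if "0 \<le> x" "x \<le> 1" for x y :: real
      using that by (simp add: power_mult_distrib mult_left_le_one_le power_le_one)
    show "X1\<^sup>2 \<le> (\<Phi> Off)\<^sup>2" unfolding X1_def by (rule sc) (use str in \<open>auto intro: mult_le_one\<close>)
    show "X2\<^sup>2 \<le> (\<Phi> Diag)\<^sup>2" unfolding X2_def by (rule sc) (use str in auto)
    have "iid.expectation (\<lambda>\<omega>. (X3 \<omega>)\<^sup>2) \<le> (\<Sum>i<p. (t * \<Phi> (Row i))\<^sup>2)"
      unfolding X3_def by (rule linear_discrepancy_le[OF bb(1) i0(1)]) simp
    also have "\<dots> \<le> (\<Sum>i<p. (\<Phi> (Row i))\<^sup>2)"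
      by (intro sum_mono sc) (use str in auto)
    finally show "iid.expectation (\<lambda>\<omega>. (X3 \<omega>)\<^sup>2) \<le> (\<Sum>i<p. (\<Phi> (Row i))\<^sup>2)" .
    have "iid.expectation (\<lambda>\<omega>. (X4 \<omega>)\<^sup>2) \<le> (\<Sum>i<p. (s * \<Phi> (Col i))\<^sup>2)"
      unfolding X4_def by (rule linear_discrepancy_le[OF bb(2) i0(2)]) simp
    also have "\<dots> \<le> (\<Sum>i<p. (\<Phi> (Col i))\<^sup>2)"
      by (intro sum_mono sc) (use str in auto)
    finally show "iid.expectation (\<lambda>\<omega>. (X4 \<omega>)\<^sup>2) \<le> (\<Sum>i<p. (\<Phi> (Col i))\<^sup>2)" .
    show "iid.expectation (\<lambda>\<omega>. (X5 \<omega>)\<^sup>2) \<le> (\<Sum>i<p. (D (i, i))\<^sup>2)"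
      unfolding X5_def by (rule linear_discrepancy_le[OF bb(3) i0(3)]) simp
    show "iid.expectation (\<lambda>\<omega>. (X6 \<omega>)\<^sup>2) \<le> (\<Sum>c\<in>L. (D c)\<^sup>2)"
      unfolding X6_def by (rule quadratic_discrepancy_le[OF bb(1) i0(1) bb(2) i0(2) LU(1)]) (auto simp: L_def)
    show "iid.expectation (\<lambda>\<omega>. (X7 \<omega>)\<^sup>2) \<le> (\<Sum>c\<in>U. (D c)\<^sup>2)"
      unfolding X7_def by (rule quadratic_discrepancy_le[OF bb(1) i0(1) bb(2) i0(2) LU(2)]) (auto simp: U_def)
  qed auto
  also have "\<dots> = 8 * (\<Sum>f\<in>features p. (\<Phi> f)\<^sup>2)"
  proof -
    \<comment> \<open>The diagonal and the two triangles partition \<open>C\<close>; together they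
      supply the \<open>Entry\<close> features.\<close>
    define I where "I = (\<lambda>i. (i, i)) ` {..<p}"
    have "C = I \<union> (L \<union> U)"
      by (auto simp: C_def I_def L_def U_def image_iff)
    then have "(\<Sum>c\<in>C. (D c)\<^sup>2) = (\<Sum>c\<in>I. (D c)\<^sup>2) + ((\<Sum>c\<in>L. (D c)\<^sup>2) + (\<Sum>c\<in>U. (D c)\<^sup>2))"
      using LU by (subst sum.union_disjoint[symmetric], simp, simp, simp)
         (simp, intro sum.union_disjoint, auto simp: I_def L_def U_def)
    moreover have "(\<Sum>c\<in>I. (D c)\<^sup>2) = (\<Sum>i<p. (D (i, i))\<^sup>2)"
      unfolding I_def by (subst sum.reindex) (auto simp: inj_on_def)
    moreover have "\<Phi> (Entry e) = D e" if "e \<in> C" for e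
    proof -
      have "\<Phi> (Entry e) = (\<Sum>c\<in>C. if c = e then D c else 0)"
        unfolding \<Phi>_def by (intro sum.cong) auto
      then show ?thesis using C that by simp
    qed
    ultimately show ?thesis
      unfolding sum_features by (simp add: C_def[symmetric])
  qed
  finally show ?thesis
    unfolding X_def \<Phi>_def C_def .
qed

section \<open>Finite weighted graphs approximate grapheurs\<close>

lemma emeasure_grapheur_measure_mono:
  assumes "\<And>i j. E' i j \<le> E i j" "\<And>i. \<sigma>' i \<le> \<sigma> i" "\<And>i. vs' i \<le> vs i" "\<theta>' \<le> \<theta>" "vt' \<le> vt"
    and A: "A \<in> sets borel"
  shows "emeasure (grapheur_measure E' \<sigma>' vs' \<theta>' vt' t) A \<le> emeasure (grapheur_measure E \<sigma> vs \<theta> vt t) A"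
  unfolding emeasure_grapheur_measure[OF A]
  by (intro add_mono suminf_le mult_right_mono ennreal_leI assms) auto

text \<open>The upper bound is domination applied to the complement of \<open>A\<close>: on no set
  can \<open>M\<close> exceed \<open>N\<close> by more than the total missing mass.\<close>

lemma measure_submeasure_bounds:
  assumes "prob_space M" "sets N = sets M"
    and le: "\<And>A. A \<in> sets M \<Longrightarrow> emeasure N A \<le> emeasure M A" and A: "A \<in> sets M"
  shows "measure N A \<le> measure M A" "measure M A \<le> measure N A + (1 - measure N (space M))"
proof -
  interpret M: prob_space M by fact
  have sp: "space N = space M" using assms(2) by (rule sets_eq_imp_space_eq)
  interpret N: finite_measure N
    using le[of "space M"] by (intro finite_measureI) (auto simp: sp M.emeasure_space_1 top_unique)
  have le': "measure N A \<le> measure M A" if "A \<in> sets M" for A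
    using le[OF that] by (simp add: M.emeasure_eq_measure N.emeasure_eq_measure)
  show "measure N A \<le> measure M A" using le' A .
  have "measure N (space M - A) \<le> measure M (space M - A)" using A by (intro le') auto
  then show "measure M A \<le> measure N A + (1 - measure N (space M))"
    using A N.finite_measure_compl[of A] M.prob_compl[of A] by (simp add: sp assms(2))
qed

text \<open>Truncation turns the series into finite sums, so the mass of a rectangle becomes a real
  expression in indicators and values of \<open>unif\<close>. In this form \<open>unif\<close> can
  be replaced by an empirical measure.\<close>

lemma measure_finite_grapheur:
  assumes nn: "\<And>i j. 0 \<le> E i j" "\<And>i. 0 \<le> \<sigma> i" "\<And>i. 0 \<le> vs i" "0 \<le> \<theta>" "0 \<le> vt"
    and S: "S \<in> sets borel" and T: "T \<in> sets borel"
  shows "measure (grapheur_measure (\<lambda>i j. if i < n \<and> j < n then E i j else 0)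
      (\<lambda>i. if i < n then \<sigma> i else 0) (\<lambda>i. if i < n then vs i else 0) \<theta> vt t) (S \<times> T)
    = (\<Sum>i<n. \<Sum>j<n. E i j * (indicator S (t i) * indicator T (t j)))
      + (\<Sum>i<n. \<sigma> i * indicator S (t i)) * measure unif T
      + (\<Sum>i<n. vs i * indicator T (t i)) * measure unif S
      + \<theta> * (measure unif S * measure unif T) + vt * measure unif (S \<inter> T)"
    (is "measure ?M _ = ?r")
proof -
  note measure_uniform_measure[simp del]
  have ST: "S \<times> T \<in> sets borel" using S T by (rule borel_Times)
  have u: "emeasure lborel ({0..1} \<inter> A) = ennreal (measure unif A)" if "A \<in> sets borel" for A
    using emeasure_unif[OF that] unif.emeasure_eq_measure[of A] by simp
  have 1: "(\<Sum>i. \<Sum>j. ennreal (if i < n \<and> j < n then E i j else 0) * indicator (S \<times> T) (t i, t j))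
     = ennreal (\<Sum>i<n. \<Sum>j<n. E i j * (indicator S (t i) * indicator T (t j)))"
  proof -
    have "(\<Sum>j. ennreal (if i < n \<and> j < n then E i j else 0) * indicator (S \<times> T) (t i, t j))
      = (if i < n then \<Sum>j<n. ennreal (E i j * (indicator S (t i) * indicator T (t j))) else 0)" for i
    proof -
      have "(\<Sum>j. ennreal (if i < n \<and> j < n then E i j else 0) * indicator (S \<times> T) (t i, t j))
        = (\<Sum>j<n. ennreal (if i < n \<and> j < n then E i j else 0) * indicator (S \<times> T) (t i, t j))"
        by (rule suminf_finite) auto
      also have "\<dots> = (if i < n then \<Sum>j<n. ennreal (E i j * (indicator S (t i) * indicator T (t j))) else 0)"
      proof (cases "i < n")
        case True
        have "ennreal (if i < n \<and> j < n then E i j else 0) * indicator (S \<times> T) (t i, t j)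
            = ennreal (E i j * (indicator S (t i) * indicator T (t j)))" if "j \<in> {..<n}" for j
          using that True by (simp add: indicator_def)
        from sum.cong[OF refl this] show ?thesis using True by (simp only: if_True)
      qed simp
      finally show ?thesis .
    qed
    then have "(\<Sum>i. \<Sum>j. ennreal (if i < n \<and> j < n then E i j else 0) * indicator (S \<times> T) (t i, t j))
      = (\<Sum>i<n. \<Sum>j<n. ennreal (E i j * (indicator S (t i) * indicator T (t j))))"
      by (simp only:) (subst suminf_finite[of "{..<n}"], auto)
    then show ?thesis
      using nn by (simp add: sum_nonneg)
  qed
  have sect: "{y \<in> {0..1}. (x, y) \<in> S \<times> T} = (if x \<in> S then {0..1} \<inter> T else {})"
    "{y \<in> {0..1}. (y, x) \<in> S \<times> T} = (if x \<in> T then {0..1} \<inter> S else {})" for x by auto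
  have 2: "(\<Sum>i. ennreal (if i < n then \<sigma> i else 0) * emeasure lborel {y \<in> {0..1}. (t i, y) \<in> S \<times> T})
      = ennreal ((\<Sum>i<n. \<sigma> i * indicator S (t i)) * measure unif T)"
  proof -
    have "(\<Sum>i. ennreal (if i < n then \<sigma> i else 0) * emeasure lborel {y \<in> {0..1}. (t i, y) \<in> S \<times> T})
      = (\<Sum>i<n. ennreal (\<sigma> i * indicator S (t i) * measure unif T))"
      unfolding sect using nn
      by (subst suminf_finite[of "{..<n}"]) (auto intro!: sum.cong simp: u T indicator_def ennreal_mult)
    also have "\<dots> = ennreal (\<Sum>i<n. \<sigma> i * indicator S (t i) * measure unif T)"
      by (rule sum_ennreal) (use nn in simp)
    finally show ?thesis by (simp only: sum_distrib_right)
  qed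
  have 3: "(\<Sum>i. ennreal (if i < n then vs i else 0) * emeasure lborel {y \<in> {0..1}. (y, t i) \<in> S \<times> T})
      = ennreal ((\<Sum>i<n. vs i * indicator T (t i)) * measure unif S)"
  proof -
    have "(\<Sum>i. ennreal (if i < n then vs i else 0) * emeasure lborel {y \<in> {0..1}. (y, t i) \<in> S \<times> T})
      = (\<Sum>i<n. ennreal (vs i * indicator T (t i) * measure unif S))"
      unfolding sect using nn
      by (subst suminf_finite[of "{..<n}"]) (auto intro!: sum.cong simp: u S indicator_def ennreal_mult)
    also have "\<dots> = ennreal (\<Sum>i<n. vs i * indicator T (t i) * measure unif S)"
      by (rule sum_ennreal) (use nn in simp)
    finally show ?thesis by (simp only: sum_distrib_right)
  qed
  have 4: "ennreal \<theta> * emeasure lborel (S \<times> T \<inter> ({0..1} \<times> {0..1})) = ennreal (\<theta> * (measure unif S * measure unif T))"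
  proof -
    have "S \<times> T \<inter> ({0..1} \<times> {0..1}) = ({0..1} \<inter> S) \<times> ({0..1} \<inter> T)" by auto
    then have "emeasure lborel (S \<times> T \<inter> ({0..1} \<times> {0..1})) = emeasure lborel ({0..1} \<inter> S) * emeasure lborel ({0..1} \<inter> T)"
      using S T by (simp add: lborel_prod[symmetric] lborel.emeasure_pair_measure_Times)
    then show ?thesis using nn by (simp add: u S T ennreal_mult)
  qed
  have "{x \<in> {0..1}. (x, x) \<in> S \<times> T} = {0..1} \<inter> (S \<inter> T)" by auto
  then have 5: "ennreal vt * emeasure lborel {x \<in> {0..1}. (x, x) \<in> S \<times> T} = ennreal (vt * measure unif (S \<inter> T))"
    using nn u[of "S \<inter> T"] S T by (simp add: ennreal_mult)
  have "emeasure ?M (S \<times> T) = ennreal ?r"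
    unfolding emeasure_grapheur_measure[OF ST] 1 2 3 4 5
    using nn by (simp add: sum_nonneg ennreal_plus[symmetric] del: ennreal_plus)
  moreover have "0 \<le> ?r"
    using nn by (intro add_nonneg_nonneg mult_nonneg_nonneg sum_nonneg) auto
  ultimately show ?thesis
    by (intro measure_eq_emeasure_eq_ennreal)
qed

text \<open>The truncated masses converge to the total mass 1. For the double series this holds
  because squares exhaust all finite index rectangles.\<close>

lemma grapheur_truncated_mass:
  assumes g: "is_grapheur E \<sigma> vs \<theta> vt" and "\<delta> > 0"
  obtains n where "1 - \<delta> < (\<Sum>i<n. \<Sum>j<n. E i j) + (\<Sum>i<n. \<sigma> i) + (\<Sum>i<n. vs i) + \<theta> + vt"
proof -
  have nn: "\<And>i j. 0 \<le> E i j" "\<And>i. 0 \<le> \<sigma> i" "\<And>i. 0 \<le> vs i" "0 \<le> \<theta>" "0 \<le> vt"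
    using g by (auto simp: is_grapheur_def)
  define f where "f n = (\<Sum>i<n. \<Sum>j<n. ennreal (E i j))" for n
  have f_mono: "incseq f"
    unfolding f_def by (intro monoI order_trans[OF sum_mono sum_mono2] sum_mono2) auto
  have "f \<longlonglongrightarrow> (\<Sum>i. \<Sum>j. ennreal (E i j))"
  proof -
    have "(SUP n. f n) = (\<Sum>i. \<Sum>j. ennreal (E i j))"
    proof (rule antisym)
      show "(SUP n. f n) \<le> (\<Sum>i. \<Sum>j. ennreal (E i j))"
        unfolding f_def by (intro SUP_least order_trans[OF sum_mono sum_le_suminf] sum_le_suminf) auto
      have "(\<Sum>i<n. \<Sum>j<m. ennreal (E i j)) \<le> (SUP n. f n)" for n m
      proof -
        \<comment> \<open>An \<open>n\<close> by \<open>m\<close> rectangle of indices lies in the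
          square of side \<open>max n m\<close>.\<close>
        have "(\<Sum>i<n. \<Sum>j<m. ennreal (E i j)) \<le> f (max n m)"
          unfolding f_def by (intro order_trans[OF sum_mono sum_mono2] sum_mono2) auto
        also have "\<dots> \<le> (SUP n. f n)" by (rule SUP_upper) simp
        finally show ?thesis .
      qed
      then have "(\<Sum>j. \<Sum>i<n. ennreal (E i j)) \<le> (SUP n. f n)" for n
        by (intro suminf_le_const) (auto simp: sum.swap[of _ "{..<n}"])
      then have "(\<Sum>i<n. \<Sum>j. ennreal (E i j)) \<le> (SUP n. f n)" for n
        by (subst suminf_sum[symmetric]) auto
      then show "(\<Sum>i. \<Sum>j. ennreal (E i j)) \<le> (SUP n. f n)"
        by (intro suminf_le_const) auto
    qed
    then show ?thesis using LIMSEQ_SUP[OF f_mono] by simp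
  qed
  moreover have "(\<lambda>n. \<Sum>i<n. ennreal (\<sigma> i)) \<longlonglongrightarrow> (\<Sum>i. ennreal (\<sigma> i))"
    "(\<lambda>n. \<Sum>i<n. ennreal (vs i)) \<longlonglongrightarrow> (\<Sum>i. ennreal (vs i))"
    by (intro summable_LIMSEQ summableI)+
  ultimately have "(\<lambda>n. f n + (\<Sum>i<n. ennreal (\<sigma> i)) + (\<Sum>i<n. ennreal (vs i)) + ennreal \<theta> + ennreal vt)
      \<longlonglongrightarrow> (\<Sum>i. \<Sum>j. ennreal (E i j)) + (\<Sum>i. ennreal (\<sigma> i)) + (\<Sum>i. ennreal (vs i)) + ennreal \<theta> + ennreal vt"
    by (intro tendsto_add tendsto_const)
  moreover have "f n + (\<Sum>i<n. ennreal (\<sigma> i)) + (\<Sum>i<n. ennreal (vs i)) + ennreal \<theta> + ennreal vt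
      = ennreal ((\<Sum>i<n. \<Sum>j<n. E i j) + (\<Sum>i<n. \<sigma> i) + (\<Sum>i<n. vs i) + \<theta> + vt)" for n
    unfolding f_def using nn by (simp add: sum_nonneg)
  ultimately have "(\<lambda>n. ennreal ((\<Sum>i<n. \<Sum>j<n. E i j) + (\<Sum>i<n. \<sigma> i) + (\<Sum>i<n. vs i) + \<theta> + vt)) \<longlonglongrightarrow> ennreal 1"
    using g by (simp add: is_grapheur_def)
  then have "(\<lambda>n. (\<Sum>i<n. \<Sum>j<n. E i j) + (\<Sum>i<n. \<sigma> i) + (\<Sum>i<n. vs i) + \<theta> + vt) \<longlonglongrightarrow> 1"
    by (subst (asm) tendsto_ennreal_iff) (use nn in \<open>auto simp: sum_nonneg intro!: always_eventually\<close>)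
  from order_tendstoD(1)[OF this, of "1 - \<delta>"] \<open>\<delta> > 0\<close>
  show ?thesis using that by (auto simp: eventually_sequentially)
qed

section \<open>Replacing Lebesgue measure by an empirical measure\<close>

definition empirical :: "nat \<Rightarrow> nat \<Rightarrow> (nat \<Rightarrow> real) \<Rightarrow> real set \<Rightarrow> real" where
  "empirical n m \<omega> S = (\<Sum>q=n..<n+m. indicator S (\<omega> q)) / real m"

lemma measurable_empirical [measurable]:
  assumes [measurable]: "S \<in> sets borel"
  shows "(\<lambda>\<omega>. empirical n m \<omega> S) \<in> borel_measurable iid_uniform"
  unfolding empirical_def by measurable

lemma empirical_nonneg: "0 \<le> empirical n m \<omega> S"
  by (simp add: empirical_def sum_nonneg)

lemma empirical_le_1: "empirical n m \<omega> S \<le> 1"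
proof -
  have "(\<Sum>q=n..<n+m. indicator S (\<omega> q) :: real) \<le> (\<Sum>q=n..<n+m. 1)"
    by (intro sum_mono) (simp add: indicator_def)
  \<comment> \<open>For \<open>m = 0\<close> the quotient is 0 by the convention on
    division.\<close>
  then show ?thesis by (cases "m = 0") (simp_all add: empirical_def divide_le_eq_1)
qed

text \<open>A law of large numbers with rate: the deviation is a linear form in \<open>m\<close>
  centred terms of weight \<open>1 / m\<close>, so its second moment is at most
  \<open>1 / m\<close>.\<close>

lemma expectation_empirical_deviation:
  assumes S[measurable]: "S \<in> sets borel" and m: "m > 0"
  shows "iid.expectation (\<lambda>\<omega>. \<bar>measure unif S - empirical n m \<omega> S\<bar>) \<le> 1 / sqrt (real m)"
proof -
  have eq: "empirical n m \<omega> S - measure unif S = (\<Sum>q=n..<n+m. (1 / real m) * centered S (\<omega> q))" for \<omega>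
    using m by (simp add: empirical_def centered_def sum_subtractf sum_distrib_left[symmetric] sum_divide_distrib[symmetric] field_simps del: measure_uniform_measure)
  have bb: "unit_bounded (centered S)" by (rule unit_bounded_centered[OF S])
  have "iid.expectation (\<lambda>\<omega>. \<bar>\<Sum>q=n..<n+m. (1 / real m) * centered S (\<omega> q)\<bar>) \<le> 1 / sqrt (real m)"
  proof (rule iid.expectation_abs_le)
    show "integrable iid_uniform (\<lambda>\<omega>. \<Sum>q=n..<n+m. (1 / real m) * centered S (\<omega> q))"
      "integrable iid_uniform (\<lambda>\<omega>. (\<Sum>q=n..<n+m. (1 / real m) * centered S (\<omega> q))\<^sup>2)"
      by (intro iid.integrable_bounded_sum;
          use bb in \<open>auto simp: unit_bounded_def intro!: measurable_unit_bounded_component\<close>)+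
    have "iid.expectation (\<lambda>\<omega>. (\<Sum>q=n..<n+m. (1 / real m) * centered S (\<omega> q))\<^sup>2) \<le> (\<Sum>q=n..<n+m. (1 / real m)\<^sup>2)"
      by (rule linear_discrepancy_le[OF bb integral_centered[OF S]]) simp
    also have "\<dots> = (1 / sqrt (real m))\<^sup>2"
      using m by (simp add: power2_eq_square)
    finally show "iid.expectation (\<lambda>\<omega>. (\<Sum>q=n..<n+m. (1 / real m) * centered S (\<omega> q))\<^sup>2) \<le> (1 / sqrt (real m))\<^sup>2" .
  qed (use m in simp)
  then show ?thesis
    unfolding eq[symmetric] by (simp only: abs_minus_commute)
qed

lemma sum_lessThan_add_low:
  "(\<Sum>i<n+m. of_bool (i < n) * f i) = (\<Sum>i<n. f i :: real)" for n m :: nat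
proof -
  have "(\<Sum>i<n+m. of_bool (i < n) * f i) = (\<Sum>i<n. of_bool (i < n) * f i)"
    by (rule sum.mono_neutral_right) auto
  then show ?thesis by simp
qed

lemma sum_lessThan_add_high:
  "(\<Sum>i<n+m. of_bool (n \<le> i) * f i) = (\<Sum>i=n..<n+m. f i :: real)" for n m :: nat
proof -
  have "(\<Sum>i<n+m. of_bool (n \<le> i) * f i) = (\<Sum>i=n..<n+m. of_bool (n \<le> i) * f i)"
    by (rule sum.mono_neutral_right) auto
  then show ?thesis by simp
qed

lemma sum_of_bool_eq_mult:
  fixes f :: "'a \<Rightarrow> real"
  assumes "finite A" "a \<in> A"
  shows "(\<Sum>j\<in>A. of_bool (j = a) * f j) = f a"
proof -
  have "(\<Sum>j\<in>A. of_bool (j = a) * f j) = (\<Sum>j\<in>A. if j = a then f j else 0)"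
    by (rule sum.cong) auto
  then show ?thesis using assms by simp
qed

text \<open>The \<open>m\<close> vertices from \<open>n\<close> on carry the empirical measure that replaces \<open>\<lambda>\<close>;
  \<open>\<rho>\<close> is the mass lost by truncation, put on the loop at \<open>0\<close> to restore total weight 1.\<close>

definition blow_up ::
  "(nat \<Rightarrow> nat \<Rightarrow> real) \<Rightarrow> (nat \<Rightarrow> real) \<Rightarrow> (nat \<Rightarrow> real) \<Rightarrow> real \<Rightarrow> real \<Rightarrow> real \<Rightarrow> nat \<Rightarrow> nat \<Rightarrow>
    nat \<Rightarrow> nat \<Rightarrow> real" where
  "blow_up E \<sigma> vs \<theta> vt \<rho> n m i j =
     of_bool (i < n) * (of_bool (j < n) * E i j)
     + of_bool (i < n) * (of_bool (n \<le> j) * (\<sigma> i / real m))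
     + of_bool (n \<le> i) * (of_bool (j < n) * (vs j / real m))
     + of_bool (n \<le> i) * (of_bool (n \<le> j) * (\<theta> / (real m * real m)))
     + of_bool (n \<le> i) * (of_bool (j = i) * (vt / real m))
     + of_bool (i = 0) * (of_bool (j = 0) * \<rho>)"

text \<open>The test sequences \<open>x\<close> and \<open>y\<close> are general so that constants 1
  give the total weight and indicators give the mass of a rectangle. Positivity of \<open>m\<close>
  also puts the loop at 0 inside the index range.\<close>

lemma sum_blow_up:
  fixes x y :: "nat \<Rightarrow> real"
  assumes "m > 0"
  shows "(\<Sum>i<n+m. \<Sum>j<n+m. blow_up E \<sigma> vs \<theta> vt \<rho> n m i j * (x i * y j)) =
     (\<Sum>i<n. \<Sum>j<n. E i j * (x i * y j))
     + (\<Sum>i<n. \<sigma> i * x i) * ((\<Sum>q=n..<n+m. y q) / real m)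
     + (\<Sum>j<n. vs j * y j) * ((\<Sum>q=n..<n+m. x q) / real m)
     + \<theta> * (((\<Sum>q=n..<n+m. x q) / real m) * ((\<Sum>q=n..<n+m. y q) / real m))
     + vt * ((\<Sum>q=n..<n+m. x q * y q) / real m) + \<rho> * (x 0 * y 0)"
proof -
  let ?p = "{..<n+m}"
  \<comment> \<open>The nested shape of the summands in \<open>blow_up\<close> lets the condition on
    \<open>i\<close> leave the inner sum, so each index range is restricted separately.\<close>
  have out: "(\<Sum>i\<in>?p. \<Sum>j\<in>?p. b i * (c i j * d i j) * (x i * y j)) = (\<Sum>i\<in>?p. b i * (\<Sum>j\<in>?p. c i j * (d i j * (x i * y j))))"
    for b :: "nat \<Rightarrow> real" and c d by (simp add: sum_distrib_left mult_ac)
  have 1: "(\<Sum>i\<in>?p. \<Sum>j\<in>?p. of_bool (i < n) * (of_bool (j < n) * E i j) * (x i * y j))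
     = (\<Sum>i<n. \<Sum>j<n. E i j * (x i * y j))"
    unfolding out sum_lessThan_add_low sum_lessThan_add_high ..
  have 2: "(\<Sum>i\<in>?p. \<Sum>j\<in>?p. of_bool (i < n) * (of_bool (n \<le> j) * (\<sigma> i / real m)) * (x i * y j))
     = (\<Sum>i<n. \<sigma> i * x i) * ((\<Sum>q=n..<n+m. y q) / real m)"
    unfolding out sum_lessThan_add_low sum_lessThan_add_high
    by (simp add: sum_product sum_divide_distrib mult_ac)
  have 3: "(\<Sum>i\<in>?p. \<Sum>j\<in>?p. of_bool (n \<le> i) * (of_bool (j < n) * (vs j / real m)) * (x i * y j))
     = (\<Sum>j<n. vs j * y j) * ((\<Sum>q=n..<n+m. x q) / real m)"
    unfolding out sum_lessThan_add_low sum_lessThan_add_high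
    by (subst sum.swap) (simp add: sum_product sum_divide_distrib mult_ac)
  have 4: "(\<Sum>i\<in>?p. \<Sum>j\<in>?p. of_bool (n \<le> i) * (of_bool (n \<le> j) * (\<theta> / (real m * real m))) * (x i * y j))
     = \<theta> * (((\<Sum>q=n..<n+m. x q) / real m) * ((\<Sum>q=n..<n+m. y q) / real m))"
    unfolding out sum_lessThan_add_low sum_lessThan_add_high
    by (subst sum.swap) (simp add: sum_product sum_divide_distrib sum_distrib_left mult_ac)
  have 5: "(\<Sum>i\<in>?p. \<Sum>j\<in>?p. of_bool (n \<le> i) * (of_bool (j = i) * (vt / real m)) * (x i * y j))
     = vt * ((\<Sum>q=n..<n+m. x q * y q) / real m)"
  proof -
    have "(\<Sum>j\<in>?p. of_bool (j = i) * (vt / real m * (x i * y j))) = vt / real m * (x i * y i)" if "i \<in> {n..<n+m}" for i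
      using that by (intro sum_of_bool_eq_mult) auto
    then show ?thesis
      unfolding out sum_lessThan_add_low sum_lessThan_add_high
      by (simp add: sum_distrib_left sum_divide_distrib mult_ac)
  qed
  have 6: "(\<Sum>i\<in>?p. \<Sum>j\<in>?p. of_bool (i = 0) * (of_bool (j = 0) * \<rho>) * (x i * y j)) = \<rho> * (x 0 * y 0)"
    unfolding out using assms by (subst sum_of_bool_eq_mult; simp)+
  show ?thesis
    unfolding blow_up_def distrib_right sum.distrib 1 2 3 4 5 6 ..
qed

text \<open>The graph is fixed before \<open>S\<close> and \<open>T\<close>. The error consists of
  the mass \<open>\<rho>\<close> counted twice, once as lost by truncation and once as put back on a
  loop, and of the sampling errors for \<open>S\<close>, \<open>T\<close> and
  \<open>S \<inter> T\<close>.\<close>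

lemma finite_graph_approximation:
  assumes g: "is_grapheur E \<sigma> vs \<theta> vt" and \<eta>: "\<eta> > 0"
  obtains p and H :: "nat \<times> nat \<Rightarrow> real" where "\<And>c. 0 \<le> H c" "(\<Sum>c\<in>{..<p} \<times> {..<p}. H c) = 1"
    "\<And>S T. S \<in> sets borel \<Longrightarrow> T \<in> sets borel \<Longrightarrow>
      iid.expectation (\<lambda>\<omega>. \<bar>measure (grapheur_measure E \<sigma> vs \<theta> vt \<omega>) (S \<times> T)
        - (\<Sum>c\<in>{..<p} \<times> {..<p}. H c * (indicator S (\<omega> (fst c)) * indicator T (\<omega> (snd c))))\<bar>) \<le> \<eta>"
proof -
  note measure_uniform_measure[simp del]
  have nn: "\<And>i j. 0 \<le> E i j" "\<And>i. 0 \<le> \<sigma> i" "\<And>i. 0 \<le> vs i" "0 \<le> \<theta>" "0 \<le> vt"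
    using g by (auto simp: is_grapheur_def)
  \<comment> \<open>The lost mass enters the final bound twice, so \<open>\<eta> / 4\<close> spends
    half of the budget.\<close>
  obtain n where n: "1 - \<eta> / 4 < (\<Sum>i<n. \<Sum>j<n. E i j) + (\<Sum>i<n. \<sigma> i) + (\<Sum>i<n. vs i) + \<theta> + vt"
    using grapheur_truncated_mass[OF g, of "\<eta> / 4"] \<eta> by auto
  define \<rho> where "\<rho> = 1 - ((\<Sum>i<n. \<Sum>j<n. E i j) + (\<Sum>i<n. \<sigma> i) + (\<Sum>i<n. vs i) + \<theta> + vt)"
  define N where "N = grapheur_measure (\<lambda>i j. if i < n \<and> j < n then E i j else 0)
      (\<lambda>i. if i < n then \<sigma> i else 0) (\<lambda>i. if i < n then vs i else 0) \<theta> vt"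
  have N_UNIV: "measure (N \<omega>) UNIV = 1 - \<rho>" for \<omega>
    using measure_finite_grapheur[of E \<sigma> vs \<theta> vt UNIV UNIV n \<omega>, OF nn] unif.prob_space by (simp add: N_def \<rho>_def)
  have trunc: "measure (N \<omega>) A \<le> measure (grapheur_measure E \<sigma> vs \<theta> vt \<omega>) A"
    "measure (grapheur_measure E \<sigma> vs \<theta> vt \<omega>) A \<le> measure (N \<omega>) A + \<rho>" if "A \<in> sets borel" for A \<omega>
  proof -
    have "emeasure (N \<omega>) B \<le> emeasure (grapheur_measure E \<sigma> vs \<theta> vt \<omega>) B" if "B \<in> sets borel" for B
      unfolding N_def using nn that by (intro emeasure_grapheur_measure_mono) auto
    then show "measure (N \<omega>) A \<le> measure (grapheur_measure E \<sigma> vs \<theta> vt \<omega>) A"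
      "measure (grapheur_measure E \<sigma> vs \<theta> vt \<omega>) A \<le> measure (N \<omega>) A + \<rho>"
      using measure_submeasure_bounds[of "grapheur_measure E \<sigma> vs \<theta> vt \<omega>" "N \<omega>" A,
          OF prob_space_grapheur_measure[OF g]] that
      by (auto simp: N_UNIV) (simp_all add: N_def)
  qed
  have \<rho>: "0 \<le> \<rho>" "\<rho> \<le> \<eta> / 4"
    using trunc[of UNIV "\<lambda>_. 0"] N_UNIV[of "\<lambda>_. 0"] 
      prob_space.prob_le_1[of "grapheur_measure E \<sigma> vs \<theta> vt (\<lambda>_. 0)" UNIV, OF prob_space_grapheur_measure[OF g]] n
    by (auto simp: \<rho>_def)
  \<comment> \<open>Three deviations of size \<open>1 / sqrt m\<close> must fit into
    \<open>\<eta> / 2\<close>, which asks for \<open>sqrt m \<ge> 6 / \<eta>\<close>.\<close>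
  obtain m :: nat where "(6 / \<eta>)\<^sup>2 < real m" using reals_Archimedean2 by blast
  then have m: "m > 0" "3 / sqrt (real m) \<le> \<eta> / 2"
  proof -
    show "m > 0" using \<open>(6 / \<eta>)\<^sup>2 < real m\<close> by (metis of_nat_0 of_nat_0_less_iff le_less_trans zero_le_power2)
    have "6 / \<eta> < sqrt (real m)"
      using real_less_rsqrt[OF \<open>(6 / \<eta>)\<^sup>2 < real m\<close>] .
    then show "3 / sqrt (real m) \<le> \<eta> / 2"
      using \<eta> \<open>m > 0\<close> by (simp add: field_simps)
  qed
  define H where "H c = blow_up E \<sigma> vs \<theta> vt \<rho> n m (fst c) (snd c)" for c
  have sumH: "(\<Sum>c\<in>{..<n+m} \<times> {..<n+m}. H c * (x (fst c) * y (snd c)))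
    = (\<Sum>i<n+m. \<Sum>j<n+m. blow_up E \<sigma> vs \<theta> vt \<rho> n m i j * (x i * y j))" for x y :: "nat \<Rightarrow> real"
    unfolding sum.cartesian_product H_def by (intro sum.cong) auto
  show ?thesis
  proof (rule that[of H "n + m"])
    show "0 \<le> H c" for c
      using nn \<rho> by (simp add: H_def blow_up_def)
    show "(\<Sum>c\<in>{..<n+m} \<times> {..<n+m}. H c) = 1"
      using sumH[of "\<lambda>_. 1" "\<lambda>_. 1"] sum_blow_up[OF m(1), of E \<sigma> vs \<theta> vt \<rho> n "\<lambda>_. 1" "\<lambda>_. 1"] m(1)
      by (simp add: \<rho>_def)
    fix S T :: "real set" assume S[measurable]: "S \<in> sets borel" and T[measurable]: "T \<in> sets borel"
    let ?M = "\<lambda>\<omega>. measure (grapheur_measure E \<sigma> vs \<theta> vt \<omega>) (S \<times> T)"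
    let ?H = "\<lambda>\<omega>. \<Sum>c\<in>{..<n+m} \<times> {..<n+m}. H c * (indicator S (\<omega> (fst c)) * indicator T (\<omega> (snd c)))"
    let ?d = "\<lambda>\<omega> A. \<bar>measure unif A - empirical n m \<omega> A\<bar>"
    have bound: "\<bar>?M \<omega> - ?H \<omega>\<bar> \<le> ?d \<omega> S + ?d \<omega> T + ?d \<omega> (S \<inter> T) + 2 * \<rho>" for \<omega>
    proof -
      define s t r where "s = measure unif S" and "t = measure unif T" and "r = measure unif (S \<inter> T)"
      define s' t' r' where "s' = empirical n m \<omega> S" and "t' = empirical n m \<omega> T" and "r' = empirical n m \<omega> (S \<inter> T)"
      define A where "A = (\<Sum>i<n. \<sigma> i * indicator S (\<omega> i))"
      define B where "B = (\<Sum>i<n. vs i * indicator T (\<omega> i))"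
      define e where "e = \<rho> * (indicator S (\<omega> 0) * indicator T (\<omega> 0))"
      have A: "0 \<le> A" "A \<le> (\<Sum>i<n. \<sigma> i)" and B: "0 \<le> B" "B \<le> (\<Sum>i<n. vs i)"
        unfolding A_def B_def using nn by (intro sum_nonneg sum_mono; simp add: indicator_def)+
      have E0: "0 \<le> (\<Sum>i<n. \<Sum>j<n. E i j)" "0 \<le> (\<Sum>i<n. \<sigma> i)" "0 \<le> (\<Sum>i<n. vs i)"
        using nn by (auto intro!: sum_nonneg)
      \<comment> \<open>These are the coefficients that the deviations for \<open>T\<close>,
        \<open>S\<close> and \<open>S \<inter> T\<close> collect. Each is bounded by a part of the
        total mass 1.\<close>
      have le1: "A + \<theta> \<le> 1" "B + \<theta> \<le> 1" "vt \<le> 1"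
        using A B E0 nn(4,5) \<rho>(1) unfolding \<rho>_def by linarith+
      have e: "0 \<le> e" "e \<le> \<rho>" using \<rho>(1) by (auto simp: e_def indicator_def)
      have M: "measure (N \<omega>) (S \<times> T) = (\<Sum>i<n. \<Sum>j<n. E i j * (indicator S (\<omega> i) * indicator T (\<omega> j)))
          + A * t + B * s + \<theta> * (s * t) + vt * r"
        unfolding N_def measure_finite_grapheur[of E \<sigma> vs \<theta> vt S T n \<omega>, OF nn S T] A_def B_def s_def t_def r_def ..
      have H: "?H \<omega> = (\<Sum>i<n. \<Sum>j<n. E i j * (indicator S (\<omega> i) * indicator T (\<omega> j)))
          + A * t' + B * s' + \<theta> * (s' * t') + vt * r' + e"
        unfolding sumH[of "\<lambda>i. indicator S (\<omega> i)" "\<lambda>i. indicator T (\<omega> i)"] sum_blow_up[OF m(1)]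
          A_def B_def s'_def t'_def r'_def e_def empirical_def
        by (simp only: indicator_inter_arith)
      have 1: "\<bar>A * t - A * t'\<bar> = A * \<bar>t - t'\<bar>" "\<bar>B * s - B * s'\<bar> = B * \<bar>s - s'\<bar>" "\<bar>vt * r - vt * r'\<bar> = vt * \<bar>r - r'\<bar>"
        using A B nn(5) by (simp_all add: right_diff_distrib[symmetric] abs_mult)
      have 2: "\<bar>\<theta> * (s * t) - \<theta> * (s' * t')\<bar> \<le> \<theta> * \<bar>t - t'\<bar> + \<theta> * \<bar>s - s'\<bar>"
      proof -
        \<comment> \<open>One factor of the product is changed at a time.\<close>
        have "\<theta> * (s * t) - \<theta> * (s' * t') = \<theta> * (s * (t - t')) + \<theta> * (t' * (s - s'))" by (simp add: algebra_simps)
        moreover have "\<bar>\<theta> * (s * (t - t'))\<bar> \<le> \<theta> * \<bar>t - t'\<bar>" "\<bar>\<theta> * (t' * (s - s'))\<bar> \<le> \<theta> * \<bar>s - s'\<bar>"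
          using nn(4) by (auto simp: abs_mult s_def t'_def empirical_nonneg empirical_le_1 intro!: mult_left_mono mult_left_le_one_le)
        ultimately show ?thesis by linarith
      qed
      have 3: "A * \<bar>t - t'\<bar> + \<theta> * \<bar>t - t'\<bar> \<le> \<bar>t - t'\<bar>" "B * \<bar>s - s'\<bar> + \<theta> * \<bar>s - s'\<bar> \<le> \<bar>s - s'\<bar>" "vt * \<bar>r - r'\<bar> \<le> \<bar>r - r'\<bar>"
        unfolding distrib_right[symmetric] using A B nn(4,5) le1 by (auto intro!: mult_left_le_one_le)
      have "S \<times> T \<in> sets borel" by (rule borel_Times[OF S T])
      from trunc[OF this, of \<omega>] have "\<bar>?M \<omega> - measure (N \<omega>) (S \<times> T)\<bar> \<le> \<rho>" by linarith
      moreover have "\<bar>measure (N \<omega>) (S \<times> T) - ?H \<omega>\<bar> \<le> \<bar>s - s'\<bar> + \<bar>t - t'\<bar> + \<bar>r - r'\<bar> + \<rho>"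
        unfolding M H using 1 2 3 e by linarith
      ultimately show ?thesis unfolding s_def t_def r_def s'_def t'_def r'_def by linarith
    qed
    have dev: "integrable iid_uniform (\<lambda>\<omega>. ?d \<omega> A)" "iid.expectation (\<lambda>\<omega>. ?d \<omega> A) \<le> 1 / sqrt (real m)"
      if A[measurable]: "A \<in> sets borel" for A
    proof -
      have "\<bar>?d \<omega> A\<bar> \<le> 1" for \<omega>
        using empirical_nonneg[of n m \<omega> A] empirical_le_1[of n m \<omega> A] unif.prob_le_1[of A] measure_nonneg[of unif A] by linarith
      then show "integrable iid_uniform (\<lambda>\<omega>. ?d \<omega> A)"
        by (intro iid.integrable_const_bound[where B=1]) auto
      show "iid.expectation (\<lambda>\<omega>. ?d \<omega> A) \<le> 1 / sqrt (real m)"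
        by (rule expectation_empirical_deviation[OF A m(1)])
    qed
    have ST: "S \<inter> T \<in> sets borel" by simp
    have "iid.expectation (\<lambda>\<omega>. \<bar>?M \<omega> - ?H \<omega>\<bar>) \<le> iid.expectation (\<lambda>\<omega>. ?d \<omega> S + ?d \<omega> T + ?d \<omega> (S \<inter> T) + 2 * \<rho>)"
    proof (rule integral_mono'[OF _ bound])
      show "integrable iid_uniform (\<lambda>\<omega>. ?d \<omega> S + ?d \<omega> T + ?d \<omega> (S \<inter> T) + 2 * \<rho>)"
        using dev(1)[OF S] dev(1)[OF T] dev(1)[OF ST] by auto
      show "0 \<le> ?d \<omega> S + ?d \<omega> T + ?d \<omega> (S \<inter> T) + 2 * \<rho>" for \<omega> using \<rho>(1) by simp
    qed
    also have "\<dots> = iid.expectation (\<lambda>\<omega>. ?d \<omega> S) + iid.expectation (\<lambda>\<omega>. ?d \<omega> T) + iid.expectation (\<lambda>\<omega>. ?d \<omega> (S \<inter> T)) + 2 * \<rho>"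
      using dev(1)[OF S] dev(1)[OF T] dev(1)[OF ST] iid.prob_space by simp
    also have "\<dots> \<le> 1 / sqrt (real m) + 1 / sqrt (real m) + 1 / sqrt (real m) + 2 * (\<eta> / 4)"
      by (intro add_mono dev(2) S T ST mult_left_mono \<rho>) simp
    also have "\<dots> \<le> \<eta>" using m(2) by simp
    finally show "iid.expectation (\<lambda>\<omega>. \<bar>?M \<omega> - ?H \<omega>\<bar>) \<le> \<eta>" .
  qed
qed

section \<open>The coupling\<close>

text \<open>Injectivity on all of \<open>nat\<close> is demanded because \<open>\<beta>\<close>
  later reindexes the entire iid sequence.\<close>

lemma finite_set_enumeration:
  fixes V :: "nat set"
  assumes "finite V"
  obtains \<beta> :: "nat \<Rightarrow> nat" where "inj \<beta>" "\<beta> ` {..<card V} = V"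
proof -
  obtain h where h: "bij_betw h {0..<card V} V"
    using ex_bij_betw_nat_finite[OF assms] by blast
  \<comment> \<open>Indices past the enumeration are sent strictly above \<open>Max V\<close>, away
    from the values already taken.\<close>
  define \<beta> where "\<beta> i = (if i < card V then h i else Suc (Max V) + i)" for i
  have im: "\<beta> ` {..<card V} = V"
    using bij_betw_imp_surj_on[OF h] by (force simp: \<beta>_def lessThan_atLeast0)
  have le: "h i \<le> Max V" if "i < card V" for i
    using bij_betwE[OF h] that assms by (intro Max_ge) auto
  have "inj \<beta>"
  proof (rule injI)
    fix i j assume "\<beta> i = \<beta> j"
    then show "i = j"
      using le[of i] le[of j] inj_onD[OF bij_betw_imp_inj_on[OF h], of i j]
      by (auto simp: \<beta>_def split: if_splits)
  qed
  then show ?thesis using im that by blast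
qed

lemma measurable_reindex: "(\<lambda>\<omega>. \<omega> \<circ> \<beta>) \<in> iid_uniform \<rightarrow>\<^sub>M iid_uniform"
proof -
  have "(\<lambda>\<omega>. \<omega> \<circ> \<beta>) \<in> PiM UNIV (\<lambda>_. borel :: real measure) \<rightarrow>\<^sub>M PiM UNIV (\<lambda>_. borel)"
    by (rule measurable_PiM_single') (auto simp: comp_def space_PiM)
  then show ?thesis
    using measurable_cong_sets[OF sets_iid_uniform sets_iid_uniform] by simp
qed

text \<open>Serves to identify the second marginal of the coupling: the relabelled points are read
  off distinct coordinates and so are still iid uniform.\<close>

lemma distr_iid_uniform_reindex:
  assumes "inj \<beta>"
  shows "distr iid_uniform iid_uniform (\<lambda>\<omega>. \<omega> \<circ> \<beta>) = iid_uniform"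
proof -
  have "distr (PiM UNIV (\<lambda>_. unif)) (PiM UNIV (\<lambda>_. unif)) (\<lambda>\<omega>. \<lambda>n\<in>UNIV. \<omega> (\<beta> n)) = PiM UNIV (\<lambda>_. unif)"
    using distr_PiM_reindex[of UNIV "\<lambda>_. unif" \<beta> UNIV] assms prob_space_unif by auto
  then show ?thesis
    unfolding iid_uniform_def by (simp add: comp_def restrict_def)
qed

text \<open>One sequence drives both random measures, the second through the relabelling
  \<open>\<beta>\<close>; their joint law is a coupling. As \<open>W_box\<close> has its supremum
  outside the expectation, bounding each rectangle separately is enough.\<close>

lemma W_box_le_expectation:
  assumes g1: "is_grapheur E \<sigma> vs \<theta> vt" and g2: "is_grapheur E' \<sigma>' vs' \<theta>' vt'" and \<beta>: "inj \<beta>"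
    and le: "\<And>S T. S \<in> sets borel \<Longrightarrow> T \<in> sets borel \<Longrightarrow>
      iid.expectation (\<lambda>\<omega>. \<bar>measure (grapheur_measure E \<sigma> vs \<theta> vt \<omega>) (S \<times> T)
        - measure (grapheur_measure E' \<sigma>' vs' \<theta>' vt' (\<omega> \<circ> \<beta>)) (S \<times> T)\<bar>) \<le> \<epsilon>"
  shows "W_box (grapheur_law E \<sigma> vs \<theta> vt) (grapheur_law E' \<sigma>' vs' \<theta>' vt') \<le> ennreal \<epsilon>"
proof -
  let ?M = "grapheur_measure E \<sigma> vs \<theta> vt" and ?M' = "\<lambda>\<omega>. grapheur_measure E' \<sigma>' vs' \<theta>' vt' (\<omega> \<circ> \<beta>)"
  have M[measurable]: "?M \<in> iid_uniform \<rightarrow>\<^sub>M RPM"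
    by (rule measurable_grapheur_measure[OF g1])
  have M'[measurable]: "?M' \<in> iid_uniform \<rightarrow>\<^sub>M RPM"
    using measurable_compose[OF measurable_reindex measurable_grapheur_measure[OF g2]] .
  define \<pi> where "\<pi> = distr iid_uniform (RPM \<Otimes>\<^sub>M RPM) (\<lambda>\<omega>. (?M \<omega>, ?M' \<omega>))"
  have pair[measurable]: "(\<lambda>\<omega>. (?M \<omega>, ?M' \<omega>)) \<in> iid_uniform \<rightarrow>\<^sub>M RPM \<Otimes>\<^sub>M RPM"
    by (rule measurable_Pair[OF M M'])
  have "distr \<pi> RPM fst = grapheur_law E \<sigma> vs \<theta> vt"
    unfolding \<pi>_def grapheur_law_def by (subst distr_distr[OF measurable_fst pair]) (simp add: comp_def)
  moreover have "distr \<pi> RPM snd = grapheur_law E' \<sigma>' vs' \<theta>' vt'"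
  proof -
    have "distr \<pi> RPM snd = distr iid_uniform RPM (grapheur_measure E' \<sigma>' vs' \<theta>' vt' \<circ> (\<lambda>\<omega>. \<omega> \<circ> \<beta>))"
      unfolding \<pi>_def by (subst distr_distr[OF measurable_snd pair]) (simp add: comp_def)
    also have "\<dots> = distr (distr iid_uniform iid_uniform (\<lambda>\<omega>. \<omega> \<circ> \<beta>)) RPM (grapheur_measure E' \<sigma>' vs' \<theta>' vt')"
      by (rule distr_distr[OF measurable_grapheur_measure[OF g2] measurable_reindex, symmetric])
    finally show ?thesis
      by (simp add: distr_iid_uniform_reindex[OF \<beta>] grapheur_law_def)
  qed
  moreover have "prob_space \<pi>"
    unfolding \<pi>_def by (rule iid.prob_space_distr[OF pair])
  ultimately have "\<pi> \<in> couplings (grapheur_law E \<sigma> vs \<theta> vt) (grapheur_law E' \<sigma>' vs' \<theta>' vt')"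
    by (simp add: couplings_def \<pi>_def)
  then show ?thesis
    unfolding W_box_def
  proof (rule INF_lower2, intro SUP_least)
    fix ST :: "real set \<times> real set"
    assume "ST \<in> {(S, T). is_interval S \<and> S \<subseteq> {0..1} \<and> is_interval T \<and> T \<subseteq> {0..1}}"
    then obtain S T where ST: "ST = (S, T)" and "is_interval S" "is_interval T" by auto
    then have S: "S \<in> sets borel" and T: "T \<in> sets borel"
      by (auto intro: real_interval_borel_measurable)
    have ST': "S \<times> T \<in> sets borel" by (rule borel_Times[OF S T])
    have [measurable]: "(\<lambda>p. measure (fst p) (S \<times> T)) \<in> borel_measurable (RPM \<Otimes>\<^sub>M RPM)"
      "(\<lambda>p. measure (snd p) (S \<times> T)) \<in> borel_measurable (RPM \<Otimes>\<^sub>M RPM)"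
      using measurable_compose[OF measurable_fst measurable_measure_prob_algebra[OF ST']]
        measurable_compose[OF measurable_snd measurable_measure_prob_algebra[OF ST']] .
    have mf: "(\<lambda>p. ennreal \<bar>measure (fst p) (S \<times> T) - measure (snd p) (S \<times> T)\<bar>) \<in> borel_measurable (RPM \<Otimes>\<^sub>M RPM)"
      by measurable
    have [measurable]: "(\<lambda>\<omega>. measure (?M \<omega>) (S \<times> T)) \<in> borel_measurable iid_uniform"
      "(\<lambda>\<omega>. measure (?M' \<omega>) (S \<times> T)) \<in> borel_measurable iid_uniform"
      using measurable_compose[OF M measurable_measure_prob_algebra[OF ST']]
        measurable_compose[OF M' measurable_measure_prob_algebra[OF ST']] .
    have "(\<integral>\<^sup>+ p. ennreal \<bar>measure (fst p) (S \<times> T) - measure (snd p) (S \<times> T)\<bar> \<partial>\<pi>)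
      = (\<integral>\<^sup>+ \<omega>. ennreal \<bar>measure (?M \<omega>) (S \<times> T) - measure (?M' \<omega>) (S \<times> T)\<bar> \<partial>iid_uniform)"
      unfolding \<pi>_def
      by (subst nn_integral_distr[OF pair]) (use mf in simp_all)
    \<comment> \<open>Both measures are probabilities, so the integrand is at most 1 and the
      nonnegative integral is an ordinary expectation.\<close>
    also have "\<dots> = ennreal (iid.expectation (\<lambda>\<omega>. \<bar>measure (?M \<omega>) (S \<times> T) - measure (?M' \<omega>) (S \<times> T)\<bar>))"
    proof (intro nn_integral_eq_integral iid.integrable_const_bound[where B=1] AE_I2)
      fix \<omega>
      show "norm \<bar>measure (?M \<omega>) (S \<times> T) - measure (?M' \<omega>) (S \<times> T)\<bar> \<le> 1"
        using prob_space.prob_le_1[OF prob_space_grapheur_measure[OF g1, of \<omega>], of "S \<times> T"]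
          prob_space.prob_le_1[OF prob_space_grapheur_measure[OF g2, of "\<omega> \<circ> \<beta>"], of "S \<times> T"]
          measure_nonneg[of "?M \<omega>" "S \<times> T"] measure_nonneg[of "?M' \<omega>" "S \<times> T"]
        unfolding real_norm_def by linarith
    qed auto
    also have "\<dots> \<le> ennreal \<epsilon>"
      by (intro ennreal_leI le S T)
    finally show "(case ST of (S, T) \<Rightarrow> \<integral>\<^sup>+ p. ennreal \<bar>measure (fst p) (S \<times> T) - measure (snd p) (S \<times> T)\<bar> \<partial>\<pi>) \<le> ennreal \<epsilon>"
      by (simp add: ST)
  qed
qed

lemma is_grapheur_graph:
  assumes "in_Delta N G"
  shows "is_grapheur (\<lambda>i j. if i < N \<and> j < N then G i j else 0) (\<lambda>_. 0) (\<lambda>_. 0) 0 0"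
proof -
  have nn: "\<And>i j. i < N \<Longrightarrow> j < N \<Longrightarrow> 0 \<le> G i j" and s1: "(\<Sum>i<N. \<Sum>j<N. G i j) = 1"
    using assms by (auto simp: in_Delta_def)
  have "(\<Sum>j. ennreal (if i < N \<and> j < N then G i j else 0)) = (if i < N then \<Sum>j<N. ennreal (G i j) else 0)" for i
    by (subst suminf_finite[of "{..<N}"]) auto
  then have "(\<Sum>i. \<Sum>j. ennreal (if i < N \<and> j < N then G i j else 0)) = (\<Sum>i<N. \<Sum>j<N. ennreal (G i j))"
    by (simp only:) (subst suminf_finite[of "{..<N}"], auto)
  also have "\<dots> = (\<Sum>i<N. ennreal (\<Sum>j<N. G i j))"
    using nn by (intro sum.cong refl sum_ennreal) auto
  also have "\<dots> = ennreal (\<Sum>i<N. \<Sum>j<N. G i j)"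
    using nn by (intro sum_ennreal sum_nonneg) auto
  finally show ?thesis
    using nn s1 by (simp add: is_grapheur_def)
qed

section \<open>Choice of the graph and the final estimate\<close>

theorem mainTheorem13:
  fixes E :: "nat \<Rightarrow> nat \<Rightarrow> real" and \<sigma> vs :: "nat \<Rightarrow> real" and \<theta> vt \<epsilon> :: real
  assumes "is_grapheur E \<sigma> vs \<theta> vt" and "\<epsilon> > 0"
  shows "let k = nat \<lceil>(174 / \<epsilon>)^2\<rceil> in
    \<exists>N G. N \<le> 2 * k \<and> in_Delta N G \<and>
      (\<forall>i<N. \<forall>j<N. \<exists>m::nat. G i j = real m / real k) \<and>
      W_box (grapheur_law E \<sigma> vs \<theta> vt) (graph_law N G) \<le> ennreal \<epsilon>"
proof -
  define k where "k = nat \<lceil>(174 / \<epsilon>)^2\<rceil>"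
  have k_ge: "(174 / \<epsilon>)\<^sup>2 \<le> real k"
    unfolding k_def by (rule real_nat_ceiling_ge)
  moreover have "(174 / \<epsilon>)\<^sup>2 > 0" using assms(2) by simp
  ultimately have k0: "k > 0" by (metis of_nat_0_less_iff less_le_trans)
  \<comment> \<open>Half of \<open>\<epsilon>\<close> pays for the approximation by
    \<open>H\<close>, the other half for sampling its edges.\<close>
  obtain p H where H: "\<And>c. 0 \<le> H c" "(\<Sum>c\<in>{..<p} \<times> {..<p}. H c) = 1"
    and approx: "\<And>S T. S \<in> sets borel \<Longrightarrow> T \<in> sets borel \<Longrightarrow>
      iid.expectation (\<lambda>\<omega>. \<bar>measure (grapheur_measure E \<sigma> vs \<theta> vt \<omega>) (S \<times> T)
        - (\<Sum>c\<in>{..<p} \<times> {..<p}. H c * (indicator S (\<omega> (fst c)) * indicator T (\<omega> (snd c))))\<bar>) \<le> \<epsilon> / 2"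
    by (rule finite_graph_approximation[OF assms(1) half_gt_zero[OF assms(2)]]) (rule that; assumption)
  define C where "C = {..<p} \<times> {..<p}"
  obtain e where e: "\<And>l. l < k \<Longrightarrow> e l \<in> C"
    and energy: "(\<Sum>f\<in>features p. (\<Sum>c\<in>C.
        (real (card {l. l < k \<and> e l = c}) / real k - H c) * feature_val c f)\<^sup>2) \<le> 4 / real k"
    by (rule sparse_graph_sampling[of p H k, OF H(1) H(2) k0, folded C_def]) (rule that; assumption)
  define w where "w c = real (card {l. l < k \<and> e l = c}) / real k" for c
  \<comment> \<open>Each of the \<open>k\<close> chosen edges has at most two endpoints, which is
    the source of the bound \<open>2 * k\<close> on the vertices.\<close>
  define V where "V = (fst \<circ> e) ` {..<k} \<union> (snd \<circ> e) ` {..<k}"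
  have V: "finite V" "card V \<le> 2 * k"
    using card_Un_le[of "(fst \<circ> e) ` {..<k}" "(snd \<circ> e) ` {..<k}"]
      card_image_le[of "{..<k}" "fst \<circ> e"] card_image_le[of "{..<k}" "snd \<circ> e"] by (auto simp: V_def)
  have VC: "V \<times> V \<subseteq> C" using e by (auto simp: V_def C_def mem_Times_iff)
  have w0: "w c = 0" if "c \<notin> V \<times> V" for c
  proof -
    have "e l \<in> V \<times> V" if "l < k" for l
      using that by (auto simp: V_def mem_Times_iff)
    then have "{l. l < k \<and> e l = c} = {}" using that by auto
    then show ?thesis by (simp only: w_def) simp
  qed
  obtain \<beta> where \<beta>: "inj \<beta>" "\<beta> ` {..<card V} = V"
    using finite_set_enumeration[OF V(1)] .
  define N where "N = card V"
  define G where "G i j = w (\<beta> i, \<beta> j)" for i j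
  \<comment> \<open>The test function is general: the constant 1 yields \<open>in_Delta\<close>,
    products of indicators yield the masses of rectangles.\<close>
  have sumG: "(\<Sum>i<N. \<Sum>j<N. G i j * \<phi> (\<beta> i, \<beta> j)) = (\<Sum>c\<in>C. w c * \<phi> c)" for \<phi>
  proof -
    have "(\<Sum>i<N. \<Sum>j<N. G i j * \<phi> (\<beta> i, \<beta> j)) = (\<Sum>c\<in>{..<N} \<times> {..<N}. w (map_prod \<beta> \<beta> c) * \<phi> (map_prod \<beta> \<beta> c))"
      unfolding sum.cartesian_product G_def by (intro sum.cong) auto
    also have "\<dots> = (\<Sum>c\<in>map_prod \<beta> \<beta> ` ({..<N} \<times> {..<N}). w c * \<phi> c)"
      using \<beta>(1) by (subst sum.reindex) (auto simp: inj_on_def inj_def)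
    also have "map_prod \<beta> \<beta> ` ({..<N} \<times> {..<N}) = V \<times> V"
      using \<beta>(2) by (simp add: map_prod_surj_on N_def)
    also have "(\<Sum>c\<in>V \<times> V. w c * \<phi> c) = (\<Sum>c\<in>C. w c * \<phi> c)"
      using VC w0 by (intro sum.mono_neutral_left) (auto simp: C_def)
    finally show ?thesis .
  qed
  have "(\<Sum>c\<in>C. w c) = 1"
  proof -
    have "finite C" by (simp add: C_def)
    then have "(\<Sum>c\<in>C. \<Sum>l | l \<in> {..<k} \<and> e l = c. 1::real) = (\<Sum>l<k. 1)"
      using e by (intro sum.group) auto
    then have "(\<Sum>c\<in>C. real (card {l. l < k \<and> e l = c})) = real k" by simp
    then show ?thesis using k0 by (simp add: w_def sum_divide_distrib[symmetric])
  qed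
  then have \<Delta>: "in_Delta N G"
    using sumG[of "\<lambda>_. 1"] by (simp add: in_Delta_def G_def w_def)
  have "W_box (grapheur_law E \<sigma> vs \<theta> vt) (graph_law N G) \<le> ennreal \<epsilon>"
    unfolding graph_law_def
  proof (rule W_box_le_expectation[OF assms(1) is_grapheur_graph[OF \<Delta>] \<beta>(1)])
    fix S T :: "real set" assume S[measurable]: "S \<in> sets borel" and T[measurable]: "T \<in> sets borel"
    let ?M = "\<lambda>\<omega>. measure (grapheur_measure E \<sigma> vs \<theta> vt \<omega>) (S \<times> T)"
    let ?f = "\<lambda>c \<omega>. indicator S (\<omega> (fst c)) * indicator T (\<omega> (snd c)) :: real"
    let ?M' = "\<lambda>\<omega>. measure (grapheur_measure (\<lambda>i j. if i < N \<and> j < N then G i j else 0) (\<lambda>_. 0) (\<lambda>_. 0) 0 0 (\<omega> \<circ> \<beta>)) (S \<times> T)"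
    let ?X = "\<lambda>\<omega>. \<Sum>c\<in>C. (w c - H c) * ?f c \<omega>"
    \<comment> \<open>Vertex \<open>i\<close> of \<open>G\<close> sits at
      \<open>\<omega> (\<beta> i)\<close>, the point used by vertex \<open>\<beta> i\<close> of
      \<open>H\<close>. Hence both graphs are summed over \<open>C\<close> against the same
      indicators.\<close>
    have M': "?M' \<omega> = (\<Sum>c\<in>C. w c * ?f c \<omega>)" for \<omega>
    proof -
      have "?M' \<omega> = (\<Sum>i<N. \<Sum>j<N. G i j * (indicator S (\<omega> (\<beta> i)) * indicator T (\<omega> (\<beta> j))))"
        using measure_finite_grapheur[of G "\<lambda>_. 0" "\<lambda>_. 0" 0 0 S T N "\<omega> \<circ> \<beta>"] S T
        by (simp add: G_def w_def)
      then show ?thesis using sumG[of "\<lambda>c. ?f c \<omega>"] by simp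
    qed
    have intX: "integrable iid_uniform ?X" "integrable iid_uniform (\<lambda>\<omega>. (?X \<omega>)\<^sup>2)"
      by (rule iid.integrable_bounded_sum; auto simp: indicator_def)+
    \<comment> \<open>The 8 is the constant of \<open>graph_discrepancy_sq_le\<close>, and
      \<open>4 / k\<close> is the sampling error in the features.\<close>
    have "iid.expectation (\<lambda>\<omega>. (?X \<omega>)\<^sup>2) \<le> 8 * (4 / real k)"
      using graph_discrepancy_sq_le[OF S T, of "\<lambda>c. w c - H c" p] energy
      unfolding C_def[symmetric] w_def[symmetric] by linarith
    also have "\<dots> \<le> (\<epsilon> / 2)\<^sup>2"
    proof -
      \<comment> \<open>The target \<open>32 / k \<le> \<epsilon>^2 / 4\<close> amounts to
        \<open>k * \<epsilon>^2 \<ge> 128\<close>; the choice of \<open>k\<close> supplies 174^2 =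
        30276.\<close>
      have "30276 \<le> real k * \<epsilon>\<^sup>2"
        using k_ge assms(2) by (simp add: power_divide field_simps)
      then show ?thesis using k0 by (simp add: field_simps)
    qed
    finally have X: "iid.expectation (\<lambda>\<omega>. \<bar>?X \<omega>\<bar>) \<le> \<epsilon> / 2"
      using assms(2) by (intro iid.expectation_abs_le intX) auto
    have [measurable]: "?M \<in> borel_measurable iid_uniform"
      using measurable_compose[OF measurable_grapheur_measure[OF assms(1)] measurable_measure_prob_algebra[OF borel_Times[OF S T]]] .
    have intM: "integrable iid_uniform ?M"
      using prob_space.prob_le_1[OF prob_space_grapheur_measure[OF assms(1)]]
      by (intro iid.integrable_const_bound[where B=1]) auto
    have intH: "integrable iid_uniform (\<lambda>\<omega>. \<Sum>c\<in>C. H c * ?f c \<omega>)"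
      by (rule iid.integrable_bounded_sum; auto simp: indicator_def)
    \<comment> \<open>Triangle inequality with the weighted graph \<open>H\<close> as the
      intermediate point.\<close>
    have "iid.expectation (\<lambda>\<omega>. \<bar>?M \<omega> - ?M' \<omega>\<bar>)
      \<le> iid.expectation (\<lambda>\<omega>. \<bar>?M \<omega> - (\<Sum>c\<in>C. H c * ?f c \<omega>)\<bar> + \<bar>?X \<omega>\<bar>)"
    proof (rule integral_mono')
      show "integrable iid_uniform (\<lambda>\<omega>. \<bar>?M \<omega> - (\<Sum>c\<in>C. H c * ?f c \<omega>)\<bar> + \<bar>?X \<omega>\<bar>)"
        by (intro Bochner_Integration.integrable_add integrable_abs Bochner_Integration.integrable_diff intM intH intX)
      fix \<omega>
      have "?X \<omega> = ?M' \<omega> - (\<Sum>c\<in>C. H c * ?f c \<omega>)"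
        unfolding M' by (simp only: left_diff_distrib sum_subtractf)
      then show "\<bar>?M \<omega> - ?M' \<omega>\<bar> \<le> \<bar>?M \<omega> - (\<Sum>c\<in>C. H c * ?f c \<omega>)\<bar> + \<bar>?X \<omega>\<bar>"
        by linarith
    qed simp
    also have "\<dots> = iid.expectation (\<lambda>\<omega>. \<bar>?M \<omega> - (\<Sum>c\<in>C. H c * ?f c \<omega>)\<bar>) + iid.expectation (\<lambda>\<omega>. \<bar>?X \<omega>\<bar>)"
      by (intro Bochner_Integration.integral_add integrable_abs Bochner_Integration.integrable_diff intM intH intX)
    also have "\<dots> \<le> \<epsilon>"
      using approx[OF S T] X unfolding C_def by linarith
    finally show "iid.expectation (\<lambda>\<omega>. \<bar>?M \<omega> - ?M' \<omega>\<bar>) \<le> \<epsilon>" .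
  qed
  moreover have "\<forall>i<N. \<forall>j<N. \<exists>m::nat. G i j = real m / real k"
    unfolding G_def w_def by blast
  ultimately show ?thesis
    using V(2) \<Delta> unfolding Let_def k_def[symmetric] N_def by blast
qed

end
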